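(* The Banach space $K(\ell_2,\ell_2)$ has no Besselian Schauder frame (and consequently has no unconditional Schauder frame).
   Context: $K(E,F)$ is the Banach space of all compact linear operators $E\to F$ with the operator norm. A Schauder frame for a Banach space $E$ is a sequence $((a_n,b_n^* ))_{n\ge1}$ in $E\times E^*$ such that for every $x\in E$ the series $\sum_n b_n^*(x)a_n$ converges in norm to $x$; it is an unconditional Schauder frame if all these series converge unconditionally, and a Besselian Schauder frame if there is $B>0$ with $\sum_{n=1}^\infty|b_n^*(x)||y^*(a_n)|\le B\|x\|_E\|y^*\|_{E^*}$ for all $x\in E$, $y^*\in E^*$. *)

theory Defs
  imports "HOL-Analysis.Analysis"
begin

section \<open>Frames in Banach spaces over the real or complex scalars\<close>

text \<open>
  The scalar field is a type \<open>'k\<close>, and the scalar multiplication of a space is passed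
  explicitly as \<open>smul\<close>, as in the library locale \<^locale>\<open>vector_space\<close>. Results are stated
  for \<open>'k\<close> of sort \<open>{real_normed_field, euclidean_space}\<close>, which has the types \<open>real\<close> and
  \<open>complex\<close> as instances (and, up to isomorphism, no others).
\<close>

text \<open>The norm of a functional in the dual is \<^const>\<open>onorm\<close>.\<close>

definition dual ::
  "('k::real_normed_field \<Rightarrow> 'e::real_normed_vector \<Rightarrow> 'e) \<Rightarrow> ('e \<Rightarrow> 'k) set" where
  "dual smul = {f. Vector_Spaces.linear smul (*) f \<and> bounded_linear f}"

definition unconditionally_convergent :: "(nat \<Rightarrow> 'e::real_normed_vector) \<Rightarrow> bool" where
  "unconditionally_convergent f \<longleftrightarrow> (\<forall>p. bij p \<longrightarrow> summable (\<lambda>n. f (p n)))"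

definition schauder_frame ::
  "('k::real_normed_field \<Rightarrow> 'e::banach \<Rightarrow> 'e) \<Rightarrow> (nat \<Rightarrow> 'e) \<Rightarrow> (nat \<Rightarrow> 'e \<Rightarrow> 'k) \<Rightarrow> bool" where
  "schauder_frame smul a b \<longleftrightarrow>
     (\<forall>n. b n \<in> dual smul) \<and> (\<forall>x. (\<lambda>n. smul (b n x) (a n)) sums x)"

definition unconditional_schauder_frame ::
  "('k::real_normed_field \<Rightarrow> 'e::banach \<Rightarrow> 'e) \<Rightarrow> (nat \<Rightarrow> 'e) \<Rightarrow> (nat \<Rightarrow> 'e \<Rightarrow> 'k) \<Rightarrow> bool" where
  "unconditional_schauder_frame smul a b \<longleftrightarrow>
     schauder_frame smul a b \<and>
     (\<forall>x. unconditionally_convergent (\<lambda>n. smul (b n x) (a n)))"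

text \<open>Summability is required explicitly because \<^const>\<open>suminf\<close> is unspecified on divergent series.\<close>

definition besselian_schauder_frame ::
  "('k::real_normed_field \<Rightarrow> 'e::banach \<Rightarrow> 'e) \<Rightarrow> (nat \<Rightarrow> 'e) \<Rightarrow> (nat \<Rightarrow> 'e \<Rightarrow> 'k) \<Rightarrow> bool" where
  "besselian_schauder_frame smul a b \<longleftrightarrow>
     schauder_frame smul a b \<and>
     (\<exists>B>0. \<forall>x. \<forall>y\<in>dual smul.
        summable (\<lambda>n. norm (b n x) * norm (y (a n))) \<and>
        (\<Sum>n. norm (b n x) * norm (y (a n))) \<le> B * norm x * onorm y)"

definition compact_operator ::
  "('k::field \<Rightarrow> 'e::real_normed_vector \<Rightarrow> 'e) \<Rightarrow> ('k \<Rightarrow> 'f::real_normed_vector \<Rightarrow> 'f) \<Rightarrow>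
   ('e \<Rightarrow> 'f) \<Rightarrow> bool" where
  "compact_operator s1 s2 T \<longleftrightarrow>
     Vector_Spaces.linear s1 s2 T \<and> compact (closure (T ` cball 0 1))"


section \<open>The Banach space of square-summable sequences\<close>

lemma square_summableI:
  fixes f :: "nat \<Rightarrow> 'a::real_normed_vector"
  assumes "\<And>n. L2_set (\<lambda>i. norm (f i)) {..<n} \<le> C"
  shows "summable (\<lambda>i. (norm (f i))\<^sup>2)" "sqrt (\<Sum>i. (norm (f i))\<^sup>2) \<le> C"
proof -
  have C: "0 \<le> C" using assms[of 0] by simp
  have b: "(\<Sum>i<n. (norm (f i))\<^sup>2) \<le> C\<^sup>2" for n
  proof -
    have "(\<Sum>i<n. (norm (f i))\<^sup>2) = (L2_set (\<lambda>i. norm (f i)) {..<n})\<^sup>2"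
      by (simp add: L2_set_def sum_nonneg)
    also have "\<dots> \<le> C\<^sup>2" by (rule power_mono[OF assms]) simp
    finally show ?thesis .
  qed
  show s: "summable (\<lambda>i. (norm (f i))\<^sup>2)"
    by (rule summableI_nonneg_bounded[OF _ b]) simp
  have "(\<Sum>i. (norm (f i))\<^sup>2) \<le> C\<^sup>2" by (rule suminf_le_const[OF s b])
  then show "sqrt (\<Sum>i. (norm (f i))\<^sup>2) \<le> C" using C real_le_lsqrt by blast
qed

lemma L2_set_le_sqrt_suminf:
  fixes f :: "nat \<Rightarrow> 'a::real_normed_vector"
  assumes "summable (\<lambda>i. (norm (f i))\<^sup>2)"
  shows "L2_set (\<lambda>i. norm (f i)) {..<n} \<le> sqrt (\<Sum>i. (norm (f i))\<^sup>2)"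
  unfolding L2_set_def by (auto intro!: sum_le_suminf assms)

lemma L2_set_norm_add_le:
  fixes f g :: "nat \<Rightarrow> 'a::real_normed_vector"
  shows "L2_set (\<lambda>i. norm (f i + g i)) A \<le> L2_set (\<lambda>i. norm (f i)) A + L2_set (\<lambda>i. norm (g i)) A"
  by (rule order_trans[OF L2_set_mono L2_set_triangle_ineq]) (auto intro: norm_triangle_ineq)

lemma square_summable_add:
  fixes f g :: "nat \<Rightarrow> 'a::real_normed_vector"
  assumes "summable (\<lambda>i. (norm (f i))\<^sup>2)" "summable (\<lambda>i. (norm (g i))\<^sup>2)"
  shows "summable (\<lambda>i. (norm (f i + g i))\<^sup>2)"
    "sqrt (\<Sum>i. (norm (f i + g i))\<^sup>2) \<le> sqrt (\<Sum>i. (norm (f i))\<^sup>2) + sqrt (\<Sum>i. (norm (g i))\<^sup>2)"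
proof -
  have *: "L2_set (\<lambda>i. norm (f i + g i)) {..<n}
      \<le> sqrt (\<Sum>i. (norm (f i))\<^sup>2) + sqrt (\<Sum>i. (norm (g i))\<^sup>2)" for n
    using L2_set_norm_add_le[of f g "{..<n}"] L2_set_le_sqrt_suminf[OF assms(1), of n]
      L2_set_le_sqrt_suminf[OF assms(2), of n] by linarith
  show "summable (\<lambda>i. (norm (f i + g i))\<^sup>2)"
    "sqrt (\<Sum>i. (norm (f i + g i))\<^sup>2) \<le> sqrt (\<Sum>i. (norm (f i))\<^sup>2) + sqrt (\<Sum>i. (norm (g i))\<^sup>2)"
    using square_summableI[OF *] by auto
qed

typedef (overloaded) ('k::"{real_normed_field,banach}") ell2 =
  "{x :: nat \<Rightarrow> 'k. summable (\<lambda>i. (norm (x i))\<^sup>2)}"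
  morphisms ell2_nth Abs_ell2
  by (rule exI[of _ "\<lambda>_. 0"]) simp

setup_lifting type_definition_ell2

lemma summable_ell2: "summable (\<lambda>i. (norm (ell2_nth x i))\<^sup>2)"
  using ell2_nth[of x] by simp

lift_definition scale_ell2 :: "'k::{real_normed_field,banach} \<Rightarrow> 'k ell2 \<Rightarrow> 'k ell2"
  is "\<lambda>c x i. c * x i"
  by (simp add: norm_mult power_mult_distrib summable_mult)

instantiation ell2 :: ("{real_normed_field,banach}") real_normed_vector
begin

lift_definition zero_ell2 :: "'a ell2" is "\<lambda>_. 0" by simp

lift_definition plus_ell2 :: "'a ell2 \<Rightarrow> 'a ell2 \<Rightarrow> 'a ell2" is "\<lambda>x y i. x i + y i"
  by (rule square_summable_add)

lift_definition uminus_ell2 :: "'a ell2 \<Rightarrow> 'a ell2" is "\<lambda>x i. - x i" by simp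

lift_definition minus_ell2 :: "'a ell2 \<Rightarrow> 'a ell2 \<Rightarrow> 'a ell2" is "\<lambda>x y i. x i - y i"
proof -
  fix x y :: "nat \<Rightarrow> 'a"
  assume "summable (\<lambda>i. (norm (x i))\<^sup>2)" "summable (\<lambda>i. (norm (y i))\<^sup>2)"
  then show "summable (\<lambda>i. (norm (x i - y i))\<^sup>2)"
    using square_summable_add(1)[of x "\<lambda>i. - y i"] by simp
qed

lift_definition scaleR_ell2 :: "real \<Rightarrow> 'a ell2 \<Rightarrow> 'a ell2" is "\<lambda>r x i. r *\<^sub>R x i"
  by (simp add: power_mult_distrib summable_mult)

lift_definition norm_ell2 :: "'a ell2 \<Rightarrow> real" is "\<lambda>x. sqrt (\<Sum>i. (norm (x i))\<^sup>2)" .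

definition dist_ell2 :: "'a ell2 \<Rightarrow> 'a ell2 \<Rightarrow> real" where "dist_ell2 x y = norm (x - y)"

definition sgn_ell2 :: "'a ell2 \<Rightarrow> 'a ell2" where "sgn_ell2 x = scaleR (inverse (norm x)) x"

definition uniformity_ell2 :: "('a ell2 \<times> 'a ell2) filter" where
  [code del]: "uniformity_ell2 = (INF e\<in>{0<..}. principal {(x, y). dist x y < e})"

definition open_ell2 :: "'a ell2 set \<Rightarrow> bool" where
  [code del]: "open_ell2 S = (\<forall>x\<in>S. \<forall>\<^sub>F (x', y) in uniformity. x' = x \<longrightarrow> y \<in> S)"

instance
proof
  fix x y z :: "'a ell2" and r s :: real
  show "x + y + z = x + (y + z)" by transfer (simp add: add.assoc)
  show "x + y = y + x" by transfer (simp add: add.commute)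
  show "0 + x = x" by transfer simp
  show "- x + x = 0" by transfer simp
  show "x - y = x + - y" by transfer simp
  show "r *\<^sub>R (x + y) = r *\<^sub>R x + r *\<^sub>R y" by transfer (simp add: scaleR_add_right)
  show "(r + s) *\<^sub>R x = r *\<^sub>R x + s *\<^sub>R x" by transfer (simp add: scaleR_add_left)
  show "r *\<^sub>R s *\<^sub>R x = (r * s) *\<^sub>R x" by transfer simp
  show "1 *\<^sub>R x = x" by transfer simp
  show "dist x y = norm (x - y)" by (rule dist_ell2_def)
  show "sgn x = scaleR (inverse (norm x)) x" by (rule sgn_ell2_def)
  show "uniformity = (INF e\<in>{0<..}. principal {(x, y::'a ell2). dist x y < e})"
    by (rule uniformity_ell2_def)
  show "open S = (\<forall>x\<in>S. \<forall>\<^sub>F (x', y) in uniformity. x' = x \<longrightarrow> y \<in> S)" for S :: "'a ell2 set"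
    by (rule open_ell2_def)
  show "norm x = 0 \<longleftrightarrow> x = 0"
    by transfer (auto simp: suminf_eq_zero_iff)
  show "norm (x + y) \<le> norm x + norm y"
    by transfer (rule square_summable_add)
  show "norm (r *\<^sub>R x) = \<bar>r\<bar> * norm x"
    by transfer (simp add: power_mult_distrib suminf_mult real_sqrt_mult)
qed

end

lemma L2_set_le_norm_ell2: "L2_set (\<lambda>i. norm (ell2_nth x i)) {..<n} \<le> norm x"
  unfolding norm_ell2.rep_eq by (rule L2_set_le_sqrt_suminf[OF summable_ell2])

lemma norm_ell2_nth_le: "norm (ell2_nth x i) \<le> norm x"
  using member_le_L2_set[of "{..<Suc i}" i "\<lambda>i. norm (ell2_nth x i)"]
    L2_set_le_norm_ell2[of x "Suc i"] by simp

instance ell2 :: ("{real_normed_field,banach}") banach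
proof
  fix X :: "nat \<Rightarrow> 'a ell2"
  assume X: "Cauchy X"
  have "Cauchy (\<lambda>n. ell2_nth (X n) i)" for i
  proof (rule CauchyI)
    fix e :: real assume "0 < e"
    then obtain M where M: "\<And>m n. m \<ge> M \<Longrightarrow> n \<ge> M \<Longrightarrow> norm (X m - X n) < e"
      using CauchyD[OF X] by blast
    have "norm (ell2_nth (X m) i - ell2_nth (X n) i) < e" if "m \<ge> M" "n \<ge> M" for m n
      using M[OF that] norm_ell2_nth_le[of "X m - X n" i] by (simp add: minus_ell2.rep_eq)
    then show "\<exists>M. \<forall>m\<ge>M. \<forall>n\<ge>M. norm (ell2_nth (X m) i - ell2_nth (X n) i) < e" by blast
  qed
  then have "\<forall>i. \<exists>l. (\<lambda>n. ell2_nth (X n) i) \<longlonglongrightarrow> l"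
    using Cauchy_convergent_iff convergent_def by blast
  then obtain l where l: "\<And>i. (\<lambda>n. ell2_nth (X n) i) \<longlonglongrightarrow> l i" by metis
  have close: "\<exists>M. \<forall>m\<ge>M. \<forall>k. L2_set (\<lambda>i. norm (ell2_nth (X m) i - l i)) {..<k} \<le> e"
    if e: "0 < e" for e
  proof -
    obtain M where M: "\<And>m n. m \<ge> M \<Longrightarrow> n \<ge> M \<Longrightarrow> norm (X m - X n) < e"
      using CauchyD[OF X e] by blast
    have "L2_set (\<lambda>i. norm (ell2_nth (X m) i - l i)) {..<k} \<le> e" if m: "m \<ge> M" for m k
    proof (rule LIMSEQ_le_const2)
      show "(\<lambda>n. L2_set (\<lambda>i. norm (ell2_nth (X m) i - ell2_nth (X n) i)) {..<k})
          \<longlonglongrightarrow> L2_set (\<lambda>i. norm (ell2_nth (X m) i - l i)) {..<k}"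
        unfolding L2_set_def by (intro tendsto_intros l)
      show "\<exists>N. \<forall>n\<ge>N. L2_set (\<lambda>i. norm (ell2_nth (X m) i - ell2_nth (X n) i)) {..<k} \<le> e"
      proof (intro exI allI impI)
        fix n assume "n \<ge> M"
        then show "L2_set (\<lambda>i. norm (ell2_nth (X m) i - ell2_nth (X n) i)) {..<k} \<le> e"
          using M[OF m, of n] L2_set_le_norm_ell2[of "X m - X n" k]
          by (simp add: minus_ell2.rep_eq)
      qed
    qed
    then show ?thesis by blast
  qed
  obtain M where M: "\<And>k. L2_set (\<lambda>i. norm (ell2_nth (X M) i - l i)) {..<k} \<le> 1"
    using close[of 1] by auto
  have "summable (\<lambda>i. (norm (ell2_nth (X M) i + - (ell2_nth (X M) i - l i)))\<^sup>2)"
    by (rule square_summable_add(1)[OF summable_ell2])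
      (use square_summableI(1)[OF M] in \<open>simp add: norm_minus_commute\<close>)
  then have nth: "ell2_nth (Abs_ell2 l) = l" by (simp add: Abs_ell2_inverse)
  have "X \<longlonglongrightarrow> Abs_ell2 l"
  proof (rule LIMSEQ_I)
    fix e :: real assume "0 < e"
    then obtain N where "\<forall>m\<ge>N. \<forall>k. L2_set (\<lambda>i. norm (ell2_nth (X m) i - l i)) {..<k} \<le> e / 2"
      using close[of "e / 2"] by auto
    then have "\<forall>m\<ge>N. norm (X m - Abs_ell2 l) \<le> e / 2"
      unfolding norm_ell2.rep_eq minus_ell2.rep_eq nth
      by (intro allI impI square_summableI(2)) blast
    then show "\<exists>N. \<forall>m\<ge>N. norm (X m - Abs_ell2 l) < e"
      using \<open>0 < e\<close> by (intro exI[of _ N]) force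
  qed
  then show "convergent X" by (rule convergentI)
qed

lemma norm_scale_ell2: "norm (scale_ell2 c x) = norm c * norm x"
  by transfer (simp add: norm_mult power_mult_distrib suminf_mult real_sqrt_mult)

lemma scaleR_ell2_eq: "r *\<^sub>R x = scale_ell2 (of_real r) x"
  by transfer (simp add: scaleR_conv_of_real)

lemma vector_space_ell2: "vector_space scale_ell2"
  by standard (transfer; simp add: algebra_simps)+

lemma bounded_linear_scale_ell2: "bounded_linear (scale_ell2 c)"
proof (rule bounded_linear_intro[where K = "norm c"])
  show "norm (scale_ell2 c x) \<le> norm x * norm c" for x by (simp add: norm_scale_ell2)
  show "scale_ell2 c (x + y) = scale_ell2 c x + scale_ell2 c y" for x y
    by transfer (simp add: algebra_simps)
  show "scale_ell2 c (r *\<^sub>R x) = r *\<^sub>R scale_ell2 c x" for r x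
    by transfer simp
qed


section \<open>The Banach space of compact operators on square-summable sequences\<close>

lemma compact_closure_iff:
  fixes S :: "'a::banach set"
  shows "compact (closure S) \<longleftrightarrow> (\<forall>e>0. \<exists>k. finite k \<and> S \<subseteq> (\<Union>x\<in>k. ball x e))"
proof
  assume "compact (closure S)"
  then show "\<forall>e>0. \<exists>k. finite k \<and> S \<subseteq> (\<Union>x\<in>k. ball x e)"
    unfolding compact_eq_totally_bounded using closure_subset by (meson order_trans)
next
  assume R: "\<forall>e>0. \<exists>k. finite k \<and> S \<subseteq> (\<Union>x\<in>k. ball x e)"
  have "\<exists>k. finite k \<and> closure S \<subseteq> (\<Union>x\<in>k. ball x e)" if "e > 0" for e
  proof -
    obtain k where k: "finite k" "S \<subseteq> (\<Union>x\<in>k. ball x (e / 2))"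
      using R \<open>e > 0\<close> half_gt_zero by blast
    then have "closure S \<subseteq> (\<Union>x\<in>k. cball x (e / 2))"
      by (intro closure_minimal closed_UN) (auto simp: less_imp_le dest!: subsetD)
    also have "\<dots> \<subseteq> (\<Union>x\<in>k. ball x e)" using \<open>e > 0\<close> by auto
    finally show ?thesis using k(1) by blast
  qed
  then show "compact (closure S)"
    unfolding compact_eq_totally_bounded by (auto simp: complete_eq_closed)
qed

lemma linear_scale_ell2_iff:
  fixes T :: "'k::{real_normed_field,banach} ell2 \<Rightarrow>\<^sub>L 'k ell2"
  shows "Vector_Spaces.linear scale_ell2 scale_ell2 (blinfun_apply T) \<longleftrightarrow>
    (\<forall>c x. T (scale_ell2 c x) = scale_ell2 c (T x))"
  using vector_space_ell2[where 'a = 'k]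
  by (auto simp: Vector_Spaces.linear_def module_hom_def module_hom_axioms_def
      module_iff_vector_space blinfun.add_right)

lemma compact_closure_subset:
  fixes S :: "'a::metric_space set"
  assumes "compact K" "S \<subseteq> K"
  shows "compact (closure S)"
  using assms
  by (metis bounded_subset closed_closure closure_minimal compact_Int_closed compact_imp_closed inf.absorb2)

text \<open>
  The type \<open>\<Rightarrow>\<^sub>L\<close> only asks for real linearity; linearity over \<open>'k\<close> is part of
  \<^const>\<open>compact_operator\<close>. The norm below is inherited from \<open>\<Rightarrow>\<^sub>L\<close>, i.e. it is the operator norm.
\<close>

typedef (overloaded) ('k::"{real_normed_field,banach}") compact_ell2 =
  "{T :: 'k ell2 \<Rightarrow>\<^sub>L 'k ell2. compact_operator scale_ell2 scale_ell2 (blinfun_apply T)}"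
  morphisms blinfun_of_compact Abs_compact_ell2
proof (rule exI[of _ 0])
  have "(blinfun_apply (0 :: 'k ell2 \<Rightarrow>\<^sub>L 'k ell2)) ` cball 0 1 = {0}" by (auto intro!: image_eqI[of _ _ 0])
  then have "compact (closure (blinfun_apply (0 :: 'k ell2 \<Rightarrow>\<^sub>L 'k ell2) ` cball 0 1))" by simp
  moreover have "scale_ell2 c 0 = (0 :: 'k ell2)" for c by transfer simp
  ultimately show "0 \<in> {T :: 'k ell2 \<Rightarrow>\<^sub>L 'k ell2. compact_operator scale_ell2 scale_ell2 (blinfun_apply T)}"
    by (simp add: compact_operator_def linear_scale_ell2_iff)
qed

setup_lifting type_definition_compact_ell2

lemma compact_operator_ell2_iff:
  fixes T :: "'k::{real_normed_field,banach} ell2 \<Rightarrow>\<^sub>L 'k ell2"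
  shows "compact_operator scale_ell2 scale_ell2 (blinfun_apply T) \<longleftrightarrow>
    (\<forall>c x. T (scale_ell2 c x) = scale_ell2 c (T x)) \<and> compact (closure (T ` cball 0 1))"
  by (simp add: compact_operator_def linear_scale_ell2_iff)

lemma compact_operator_ell2_add:
  fixes S T :: "'k::{real_normed_field,banach} ell2 \<Rightarrow>\<^sub>L 'k ell2"
  assumes "compact_operator scale_ell2 scale_ell2 (blinfun_apply S)"
    and "compact_operator scale_ell2 scale_ell2 (blinfun_apply T)"
  shows "compact_operator scale_ell2 scale_ell2 (blinfun_apply (S + T))"
proof -
  have "blinfun_apply (S + T) ` cball 0 1
      \<subseteq> {x + y | x y. x \<in> closure (S ` cball 0 1) \<and> y \<in> closure (T ` cball 0 1)}"
    using closure_subset[of "S ` cball 0 1"] closure_subset[of "T ` cball 0 1"]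
    by (force simp: blinfun.add_left)
  then have "compact (closure (blinfun_apply (S + T) ` cball 0 1))"
    using assms by (intro compact_closure_subset[OF compact_sums])
      (auto simp: compact_operator_ell2_iff)
  moreover have "(S + T) (scale_ell2 c x) = scale_ell2 c ((S + T) x)" for c x
    using assms bounded_linear_scale_ell2[of c]
    by (simp add: compact_operator_ell2_iff blinfun.add_left bounded_linear.linear linear_add)
  ultimately show ?thesis by (simp add: compact_operator_ell2_iff)
qed

lemma compact_operator_ell2_comp:
  fixes T :: "'k::{real_normed_field,banach} ell2 \<Rightarrow>\<^sub>L 'k ell2"
  assumes T: "compact_operator scale_ell2 scale_ell2 (blinfun_apply T)"
  shows "compact_operator scale_ell2 scale_ell2
    (blinfun_apply (Blinfun (scale_ell2 c) o\<^sub>L T))"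
proof -
  have *: "blinfun_apply (Blinfun (scale_ell2 c) o\<^sub>L T) = (\<lambda>x. scale_ell2 c (T x))"
    by (simp add: fun_eq_iff bounded_linear_Blinfun_apply bounded_linear_scale_ell2)
  have "compact (scale_ell2 c ` closure (T ` cball 0 1))"
    using T by (intro compact_continuous_image linear_continuous_on bounded_linear_scale_ell2)
      (auto simp: compact_operator_ell2_iff)
  then have "compact (closure ((\<lambda>x. scale_ell2 c (T x)) ` cball 0 1))"
    by (rule compact_closure_subset) (use closure_subset in fastforce)
  moreover have "scale_ell2 c (scale_ell2 d x) = scale_ell2 d (scale_ell2 c x)" for d x
    by transfer (simp add: mult.left_commute)
  ultimately show ?thesis
    using T unfolding compact_operator_ell2_iff[of T] by (subst compact_operator_ell2_iff) (simp add: *)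
qed

lift_definition scale_compact ::
  "'k::{real_normed_field,banach} \<Rightarrow> 'k compact_ell2 \<Rightarrow> 'k compact_ell2"
  is "\<lambda>c T. Blinfun (scale_ell2 c) o\<^sub>L T"
  by (simp add: compact_operator_ell2_comp)

lemma Blinfun_scale_ell2_of_real:
  "Blinfun (scale_ell2 (of_real r)) o\<^sub>L T = r *\<^sub>R T"
  by (rule blinfun_eqI) (simp add: bounded_linear_Blinfun_apply bounded_linear_scale_ell2
      scaleR_ell2_eq blinfun.scaleR_left)

lemma compact_operator_ell2_scaleR:
  "compact_operator scale_ell2 scale_ell2 (blinfun_apply T) \<Longrightarrow>
   compact_operator scale_ell2 scale_ell2 (blinfun_apply (r *\<^sub>R T))"
  using compact_operator_ell2_comp[of T "of_real r"] by (simp add: Blinfun_scale_ell2_of_real)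

instantiation compact_ell2 :: ("{real_normed_field,banach}") real_normed_vector
begin

lift_definition zero_compact_ell2 :: "'a compact_ell2" is 0
  using compact_operator_ell2_scaleR[of "blinfun_of_compact undefined" 0]
    blinfun_of_compact[of undefined] by simp

lift_definition plus_compact_ell2 :: "'a compact_ell2 \<Rightarrow> 'a compact_ell2 \<Rightarrow> 'a compact_ell2"
  is "(+)"
  by (simp add: compact_operator_ell2_add)

lift_definition uminus_compact_ell2 :: "'a compact_ell2 \<Rightarrow> 'a compact_ell2" is uminus
  using compact_operator_ell2_scaleR[where r = "-1"] by auto

lift_definition minus_compact_ell2 :: "'a compact_ell2 \<Rightarrow> 'a compact_ell2 \<Rightarrow> 'a compact_ell2"
  is "(-)"
  using compact_operator_ell2_scaleR[where r = "-1"] compact_operator_ell2_add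
  by (metis diff_conv_add_uminus mem_Collect_eq scaleR_minus1_left)

lift_definition scaleR_compact_ell2 :: "real \<Rightarrow> 'a compact_ell2 \<Rightarrow> 'a compact_ell2"
  is "scaleR"
  by (simp add: compact_operator_ell2_scaleR)

lift_definition norm_compact_ell2 :: "'a compact_ell2 \<Rightarrow> real" is norm .

definition dist_compact_ell2 :: "'a compact_ell2 \<Rightarrow> 'a compact_ell2 \<Rightarrow> real" where
  "dist_compact_ell2 x y = norm (x - y)"

definition sgn_compact_ell2 :: "'a compact_ell2 \<Rightarrow> 'a compact_ell2" where
  "sgn_compact_ell2 x = scaleR (inverse (norm x)) x"

definition uniformity_compact_ell2 :: "('a compact_ell2 \<times> 'a compact_ell2) filter" where
  [code del]: "uniformity_compact_ell2 = (INF e\<in>{0<..}. principal {(x, y). dist x y < e})"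

definition open_compact_ell2 :: "'a compact_ell2 set \<Rightarrow> bool" where
  [code del]: "open_compact_ell2 S = (\<forall>x\<in>S. \<forall>\<^sub>F (x', y) in uniformity. x' = x \<longrightarrow> y \<in> S)"

instance
proof
  fix x y z :: "'a compact_ell2" and r s :: real
  show "x + y + z = x + (y + z)" by transfer (simp add: add.assoc)
  show "x + y = y + x" by transfer (simp add: add.commute)
  show "0 + x = x" by transfer simp
  show "- x + x = 0" by transfer simp
  show "x - y = x + - y" by transfer simp
  show "r *\<^sub>R (x + y) = r *\<^sub>R x + r *\<^sub>R y" by transfer (simp add: scaleR_add_right)
  show "(r + s) *\<^sub>R x = r *\<^sub>R x + s *\<^sub>R x" by transfer (simp add: scaleR_add_left)
  show "r *\<^sub>R s *\<^sub>R x = (r * s) *\<^sub>R x" by transfer simp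
  show "1 *\<^sub>R x = x" by transfer simp
  show "dist x y = norm (x - y)" by (rule dist_compact_ell2_def)
  show "sgn x = scaleR (inverse (norm x)) x" by (rule sgn_compact_ell2_def)
  show "uniformity = (INF e\<in>{0<..}. principal {(x, y::'a compact_ell2). dist x y < e})"
    by (rule uniformity_compact_ell2_def)
  show "open S = (\<forall>x\<in>S. \<forall>\<^sub>F (x', y) in uniformity. x' = x \<longrightarrow> y \<in> S)"
    for S :: "'a compact_ell2 set"
    by (rule open_compact_ell2_def)
  show "norm x = 0 \<longleftrightarrow> x = 0" by transfer simp
  show "norm (x + y) \<le> norm x + norm y" by transfer (rule norm_triangle_ineq)
  show "norm (r *\<^sub>R x) = \<bar>r\<bar> * norm x" by transfer simp
qed

end

instance compact_ell2 :: ("{real_normed_field,banach}") banach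
proof
  fix X :: "nat \<Rightarrow> 'a compact_ell2"
  assume X: "Cauchy X"
  define Y where "Y n = blinfun_of_compact (X n)" for n
  have Y: "compact_operator scale_ell2 scale_ell2 (blinfun_apply (Y n))" for n
    using blinfun_of_compact[of "X n"] by (simp add: Y_def)
  have "Cauchy Y"
    using X unfolding Y_def Cauchy_iff
    by (simp add: norm_compact_ell2.rep_eq minus_compact_ell2.rep_eq)
  then obtain T where T: "Y \<longlonglongrightarrow> T"
    using Cauchy_convergent_iff convergent_def by blast
  have lim: "(\<lambda>n. Y n x) \<longlonglongrightarrow> T x" for x
    by (intro blinfun.tendsto T tendsto_const)
  have "T (scale_ell2 c x) = scale_ell2 c (T x)" for c x
  proof (rule LIMSEQ_unique[OF lim])
    show "(\<lambda>n. Y n (scale_ell2 c x)) \<longlonglongrightarrow> scale_ell2 c (T x)"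
      using bounded_linear.tendsto[OF bounded_linear_scale_ell2 lim] Y
      by (simp add: compact_operator_ell2_iff)
  qed
  moreover have "compact (closure (T ` cball 0 1))"
    unfolding compact_closure_iff
  proof (intro allI impI)
    fix e :: real assume "0 < e"
    then obtain n where n: "norm (Y n - T) < e / 2"
      using LIMSEQ_D[OF T, of "e / 2"] by auto
    obtain k where k: "finite k" "Y n ` cball 0 1 \<subseteq> (\<Union>x\<in>k. ball x (e / 2))"
      using Y[of n] \<open>0 < e\<close> half_gt_zero
      unfolding compact_operator_ell2_iff compact_closure_iff by blast
    have "T x \<in> (\<Union>x\<in>k. ball x e)" if x: "x \<in> cball 0 1" for x
    proof -
      obtain z where z: "z \<in> k" "dist z (Y n x) < e / 2" using k(2) x by fastforce
      have "dist (Y n x) (T x) \<le> norm (Y n - T) * norm x"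
        using norm_blinfun[of "Y n - T" x] by (simp add: dist_norm blinfun.diff_left)
      also have "\<dots> \<le> norm (Y n - T) * 1" using x by (intro mult_left_mono) auto
      finally have "dist z (T x) < e"
        using z(2) n dist_triangle[of z "T x" "Y n x"] by linarith
      then show ?thesis using z(1) by auto
    qed
    then show "\<exists>k. finite k \<and> T ` cball 0 1 \<subseteq> (\<Union>x\<in>k. ball x e)" using k(1) by blast
  qed
  ultimately have "blinfun_of_compact (Abs_compact_ell2 T) = T"
    by (simp add: Abs_compact_ell2_inverse compact_operator_ell2_iff)
  then have "X \<longlonglongrightarrow> Abs_compact_ell2 T"
    using T unfolding Y_def LIMSEQ_iff
    by (simp add: norm_compact_ell2.rep_eq minus_compact_ell2.rep_eq)
  then show "convergent X" by (rule convergentI)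
qed

lemma scale_compact_apply:
  "blinfun_of_compact (scale_compact c T) x = scale_ell2 c (blinfun_of_compact T x)"
  by (simp add: scale_compact.rep_eq bounded_linear_Blinfun_apply bounded_linear_scale_ell2)

lemma compact_ell2_eqI:
  "(\<And>x. blinfun_of_compact S x = blinfun_of_compact T x) \<Longrightarrow> S = T"
  by (simp add: blinfun_eqI flip: blinfun_of_compact_inject)

lemma vector_space_compact_ell2: "vector_space scale_compact"
proof -
  interpret ell2: vector_space "scale_ell2 :: 'a \<Rightarrow> _" by (rule vector_space_ell2)
  show ?thesis
    by standard (auto intro!: compact_ell2_eqI simp: scale_compact_apply plus_compact_ell2.rep_eq
        blinfun.add_left ell2.scale_right_distrib ell2.scale_left_distrib)
qed

lemma scaleR_compact_ell2_eq: "r *\<^sub>R T = scale_compact (of_real r) T"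
  by transfer (simp add: Blinfun_scale_ell2_of_real)

end

theory Submission
  imports Defs
begin

text \<open>
  The frame is tested on \<open>n \<times> n\<close> corners with \<open>n = 2 ^ m\<close>, where the identity has trace
  \<open>n\<^sup>2 = (\<Sum>k. \<Sum>i j. b\<^sub>k(E\<^sub>i\<^sub>j) (a\<^sub>k)\<^sub>i\<^sub>j) \<le> (\<Sum>k. \<parallel>b\<^sub>k\<parallel>\<^sub>2 \<parallel>a\<^sub>k\<parallel>\<^sub>2)\<close>, with Hilbert--Schmidt norms.
  Averaging the Besselian inequality over the matrices \<open>D H D'\<close> (\<open>D, D'\<close> diagonal sign
  matrices, \<open>H\<close> a Hadamard matrix, so the operator norm is at most \<open>\<surd>n\<close>) and over the functionals
  \<open>T \<mapsto> \<langle>T \<epsilon>', \<epsilon>\<rangle>\<close> (\<open>\<epsilon>, \<epsilon>'\<close> sign vectors, so the norm is at most \<open>n\<close>), Khinchine's inequality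
  for bilinear sign sums bounds the same sum by a constant multiple of \<open>B n\<^sup>3\<^sup>/\<^sup>2\<close>, which is impossible
  for large \<open>n\<close>. An unconditional frame is Besselian by the Banach--Steinhaus theorem applied to the
  finite partial sums of the frame expansion.
\<close>

section \<open>Moments of sign sums\<close>

text \<open>Sign vectors are encoded as subsets, so that averaging over independent signs is a sum
  over \<open>Pow I\<close>.\<close>

definition sgn_of :: "'i set \<Rightarrow> 'i \<Rightarrow> real" where
  "sgn_of A i = (if i \<in> A then 1 else -1)"

lemma sgn_of_insert: "i \<noteq> a \<Longrightarrow> sgn_of (insert a A) i = sgn_of A i"
  by (simp add: sgn_of_def)

lemma abs_sgn_of [simp]: "\<bar>sgn_of A i\<bar> = 1"
  by (simp add: sgn_of_def)

lemma sum_Pow_insert: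
  fixes F :: "'i set \<Rightarrow> 'b::comm_monoid_add"
  assumes "finite I" "a \<notin> I"
  shows "(\<Sum>A\<in>Pow (insert a I). F A) = (\<Sum>A\<in>Pow I. F A + F (insert a A))"
proof -
  have inj: "inj_on (insert a) (Pow I)"
    using assms(2) by (intro inj_onI) (metis Diff_insert_absorb PowD subsetD)
  have "(\<Sum>A\<in>Pow (insert a I). F A) = (\<Sum>A\<in>Pow I. F A) + (\<Sum>A\<in>insert a ` Pow I. F A)"
    unfolding Pow_insert using assms by (intro sum.union_disjoint) auto
  then show ?thesis by (simp add: sum.reindex[OF inj] sum.distrib)
qed

lemma sum_sgn_of_insert:
  fixes x :: "'i \<Rightarrow> 'a::real_vector"
  assumes "finite I" "a \<notin> I" "A \<subseteq> I"
  shows "(\<Sum>i\<in>insert a I. sgn_of A i *\<^sub>R x i) = (\<Sum>i\<in>I. sgn_of A i *\<^sub>R x i) - x a"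
    and "(\<Sum>i\<in>insert a I. sgn_of (insert a A) i *\<^sub>R x i) = (\<Sum>i\<in>I. sgn_of A i *\<^sub>R x i) + x a"
proof -
  have "sgn_of A a = -1" "sgn_of (insert a A) a = 1" using assms by (auto simp: sgn_of_def)
  moreover have "(\<Sum>i\<in>I. sgn_of (insert a A) i *\<^sub>R x i) = (\<Sum>i\<in>I. sgn_of A i *\<^sub>R x i)"
    using assms by (intro sum.cong refl arg_cong2[where f = scaleR] sgn_of_insert) auto
  ultimately show "(\<Sum>i\<in>insert a I. sgn_of A i *\<^sub>R x i) = (\<Sum>i\<in>I. sgn_of A i *\<^sub>R x i) - x a"
    "(\<Sum>i\<in>insert a I. sgn_of (insert a A) i *\<^sub>R x i) = (\<Sum>i\<in>I. sgn_of A i *\<^sub>R x i) + x a"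
    using assms by simp_all
qed

text \<open>Both choices of each new sign occur, so the parallelogram law cancels the cross terms.
  The extra index \<open>j\<close> lets the summands live in a direct sum over \<open>J\<close>, so
  that the lemma can be iterated over two families of signs.\<close>

lemma rademacher_second_moment:
  fixes x :: "'i \<Rightarrow> 'j \<Rightarrow> 'a::real_inner"
  assumes "finite I"
  shows "(\<Sum>A\<in>Pow I. \<Sum>j\<in>J. (norm (\<Sum>i\<in>I. sgn_of A i *\<^sub>R x i j))\<^sup>2)
    = 2 ^ card I * (\<Sum>i\<in>I. \<Sum>j\<in>J. (norm (x i j))\<^sup>2)"
  using assms
proof induction
  case (insert a I)
  let ?S = "\<lambda>A j. \<Sum>i\<in>I. sgn_of A i *\<^sub>R x i j"
  have "(\<Sum>A\<in>Pow (insert a I). \<Sum>j\<in>J. (norm (\<Sum>i\<in>insert a I. sgn_of A i *\<^sub>R x i j))\<^sup>2)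
      = (\<Sum>A\<in>Pow I. (\<Sum>j\<in>J. (norm (?S A j - x a j))\<^sup>2) + (\<Sum>j\<in>J. (norm (?S A j + x a j))\<^sup>2))"
    unfolding sum_Pow_insert[OF insert(1,2)]
    by (intro sum.cong) (auto simp: sum_sgn_of_insert[OF insert(1,2), where x = "\<lambda>i. x i j" for j])
  also have "\<dots> = (\<Sum>A\<in>Pow I. 2 * (\<Sum>j\<in>J. (norm (?S A j))\<^sup>2) + 2 * (\<Sum>j\<in>J. (norm (x a j))\<^sup>2))"
    by (simp add: power2_norm_eq_inner inner_simps inner_commute algebra_simps sum_distrib_left
        flip: sum.distrib)
  finally show ?case
    using insert by (simp add: sum.distrib card_Pow algebra_simps flip: sum_distrib_left)
qed simp

text \<open>Only even powers of the cross term survive the choice of the new sign, and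
  Cauchy-Schwarz controls its square; induction then sustains the Khinchine constant 3.\<close>

lemma rademacher_fourth_moment:
  fixes x :: "'i \<Rightarrow> 'j \<Rightarrow> 'a::real_inner"
  assumes "finite I"
  shows "(\<Sum>A\<in>Pow I. (\<Sum>j\<in>J. (norm (\<Sum>i\<in>I. sgn_of A i *\<^sub>R x i j))\<^sup>2)\<^sup>2)
    \<le> 3 * 2 ^ card I * (\<Sum>i\<in>I. \<Sum>j\<in>J. (norm (x i j))\<^sup>2)\<^sup>2"
  using assms
proof induction
  case (insert a I)
  let ?S = "\<lambda>A j. \<Sum>i\<in>I. sgn_of A i *\<^sub>R x i j"
  let ?N = "\<lambda>A. \<Sum>j\<in>J. (norm (?S A j))\<^sup>2"
  define v where "v = (\<Sum>j\<in>J. (norm (x a j))\<^sup>2)"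
  define s where "s = (\<Sum>i\<in>I. \<Sum>j\<in>J. (norm (x i j))\<^sup>2)"
  have step: "(\<Sum>j\<in>J. (norm (?S A j - x a j))\<^sup>2)\<^sup>2 + (\<Sum>j\<in>J. (norm (?S A j + x a j))\<^sup>2)\<^sup>2
      \<le> 2 * (?N A)\<^sup>2 + 12 * (?N A * v) + 2 * v\<^sup>2" for A
  proof -
    \<comment> \<open>\<open>B\<close> is the cross term. The two squares add up to
      \<open>2 * (N + v)\<^sup>2 + 8 * B\<^sup>2\<close>, and \<open>B\<^sup>2 \<le> N * v\<close>
      accounts for the coefficient 12 = 4 + 8.\<close>
    define B where "B = (\<Sum>j\<in>J. inner (?S A j) (x a j))"
    have "\<bar>B\<bar> \<le> (\<Sum>j\<in>J. \<bar>norm (?S A j)\<bar> * \<bar>norm (x a j)\<bar>)"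
      unfolding B_def by (rule sum_abs[THEN order_trans], rule sum_mono) (simp add: Cauchy_Schwarz_ineq2)
    also have "\<dots> \<le> L2_set (\<lambda>j. norm (?S A j)) J * L2_set (\<lambda>j. norm (x a j)) J"
      by (rule L2_set_mult_ineq)
    also have "\<dots> = sqrt (?N A * v)"
      by (simp add: L2_set_def v_def real_sqrt_mult)
    finally have "B\<^sup>2 \<le> ?N A * v"
      by (metis real_sqrt_le_iff real_sqrt_abs)
    moreover have "(\<Sum>j\<in>J. (norm (?S A j - x a j))\<^sup>2) = ?N A + v - 2 * B"
      "(\<Sum>j\<in>J. (norm (?S A j + x a j))\<^sup>2) = ?N A + v + 2 * B"
      by (simp_all add: v_def B_def power2_norm_eq_inner inner_simps inner_commute algebra_simps
        sum_distrib_left sum.distrib sum_subtractf)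
    moreover have "(N + v - 2 * B)\<^sup>2 + (N + v + 2 * B)\<^sup>2 \<le> 2 * N\<^sup>2 + 12 * (N * v) + 2 * v\<^sup>2"
      if "B\<^sup>2 \<le> N * v" for N
      using that by (simp add: power2_eq_square algebra_simps)
    ultimately show ?thesis by simp
  qed
  have "(\<Sum>A\<in>Pow (insert a I). (\<Sum>j\<in>J. (norm (\<Sum>i\<in>insert a I. sgn_of A i *\<^sub>R x i j))\<^sup>2)\<^sup>2)
      = (\<Sum>A\<in>Pow I. (\<Sum>j\<in>J. (norm (?S A j - x a j))\<^sup>2)\<^sup>2 + (\<Sum>j\<in>J. (norm (?S A j + x a j))\<^sup>2)\<^sup>2)"
    unfolding sum_Pow_insert[OF insert(1,2)]
    by (intro sum.cong) (auto simp: sum_sgn_of_insert[OF insert(1,2), where x = "\<lambda>i. x i j" for j])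
  also have "\<dots> \<le> (\<Sum>A\<in>Pow I. 2 * (?N A)\<^sup>2 + 12 * (?N A * v) + 2 * v\<^sup>2)"
    by (rule sum_mono[OF step])
  also have "\<dots> = 2 * (\<Sum>A\<in>Pow I. (?N A)\<^sup>2) + 12 * v * (\<Sum>A\<in>Pow I. ?N A) + 2 * 2 ^ card I * v\<^sup>2"
    using insert by (simp add: sum.distrib sum_distrib_left sum_distrib_right card_Pow algebra_simps)
  \<comment> \<open>The coefficient of \<open>v\<^sup>2\<close> is enlarged from 2 to 6 so that the
    right side becomes a multiple of \<open>(v + s)\<^sup>2\<close>.\<close>
  also have "\<dots> \<le> 2 * (3 * 2 ^ card I * s\<^sup>2) + 12 * v * (2 ^ card I * s) + 6 * 2 ^ card I * v\<^sup>2"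
    using insert(3) rademacher_second_moment[OF insert(1), of x J]
    by (intro add_mono mult_left_mono mult_right_mono) (simp_all add: s_def v_def sum_nonneg)
  also have "\<dots> = 3 * 2 ^ card (insert a I) * (\<Sum>i\<in>insert a I. \<Sum>j\<in>J. (norm (x i j))\<^sup>2)\<^sup>2"
  proof -
    have "(\<Sum>i\<in>insert a I. \<Sum>j\<in>J. (norm (x i j))\<^sup>2) = v + s"
      using insert(1,2) by (simp add: v_def s_def)
    then show ?thesis using insert(1,2) by (simp add: power2_eq_square algebra_simps)
  qed
  finally show ?case .
qed simp

text \<open>A decoupled Rademacher chaos of order two, with independent signs on rows and columns.
  Its values may be operators as well as scalars.\<close>

definition chaos :: "nat \<Rightarrow> nat set \<Rightarrow> nat set \<Rightarrow> (nat \<Rightarrow> nat \<Rightarrow> 'a::real_vector) \<Rightarrow> 'a" where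
  "chaos n A C b = (\<Sum>i<n. sgn_of A i *\<^sub>R (\<Sum>j<n. sgn_of C j *\<^sub>R b i j))"

lemma chaos_second_moment:
  fixes b :: "nat \<Rightarrow> nat \<Rightarrow> 'a::real_inner"
  shows "(\<Sum>A\<in>Pow {..<n}. \<Sum>C\<in>Pow {..<n}. (norm (chaos n A C b))\<^sup>2)
    = 4 ^ n * (\<Sum>i<n. \<Sum>j<n. (norm (b i j))\<^sup>2)"
proof -
  \<comment> \<open>For fixed column signs the row signs are averaged first, with the singleton
    \<open>{()}\<close> as inner index set; then the column signs act on vectors indexed by the
    rows.\<close>
  have "(\<Sum>A\<in>Pow {..<n}. \<Sum>C\<in>Pow {..<n}. (norm (chaos n A C b))\<^sup>2)
     = (\<Sum>C\<in>Pow {..<n}. \<Sum>A\<in>Pow {..<n}. \<Sum>k\<in>{()}.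
          (norm (\<Sum>i<n. sgn_of A i *\<^sub>R (\<Sum>j<n. sgn_of C j *\<^sub>R b i j)))\<^sup>2)"
    by (subst sum.swap) (simp add: chaos_def)
  also have "\<dots> = (\<Sum>C\<in>Pow {..<n}. 2 ^ n * (\<Sum>i<n. (norm (\<Sum>j<n. sgn_of C j *\<^sub>R b i j))\<^sup>2))"
    by (subst rademacher_second_moment) auto
  also have "\<dots> = 2 ^ n * (2 ^ n * (\<Sum>j<n. \<Sum>i<n. (norm (b i j))\<^sup>2))"
    unfolding sum_distrib_left[symmetric] by (subst rademacher_second_moment) auto
  also have "\<dots> = 4 ^ n * (\<Sum>i<n. \<Sum>j<n. (norm (b i j))\<^sup>2)"
    by (subst sum.swap) (simp flip: power_mult_distrib)
  finally show ?thesis .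
qed

lemma chaos_fourth_moment:
  fixes b :: "nat \<Rightarrow> nat \<Rightarrow> 'a::real_inner"
  shows "(\<Sum>A\<in>Pow {..<n}. \<Sum>C\<in>Pow {..<n}. (norm (chaos n A C b)) ^ 4)
    \<le> 9 * 4 ^ n * (\<Sum>i<n. \<Sum>j<n. (norm (b i j))\<^sup>2)\<^sup>2"
proof -
  have "(\<Sum>A\<in>Pow {..<n}. \<Sum>C\<in>Pow {..<n}. (norm (chaos n A C b)) ^ 4)
     = (\<Sum>C\<in>Pow {..<n}. \<Sum>A\<in>Pow {..<n}. (\<Sum>k\<in>{()}.
          (norm (\<Sum>i<n. sgn_of A i *\<^sub>R (\<Sum>j<n. sgn_of C j *\<^sub>R b i j)))\<^sup>2)\<^sup>2)"
    by (subst sum.swap) (simp add: chaos_def)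
  also have "\<dots> \<le> (\<Sum>C\<in>Pow {..<n}. 3 * 2 ^ n * (\<Sum>i<n. (norm (\<Sum>j<n. sgn_of C j *\<^sub>R b i j))\<^sup>2)\<^sup>2)"
    by (rule sum_mono, rule order_trans[OF rademacher_fourth_moment]) auto
  also have "\<dots> = 3 * 2 ^ n * (\<Sum>C\<in>Pow {..<n}. (\<Sum>i<n. (norm (\<Sum>j<n. sgn_of C j *\<^sub>R b i j))\<^sup>2)\<^sup>2)"
    by (simp add: sum_distrib_left)
  also have "\<dots> \<le> 3 * 2 ^ n * (3 * 2 ^ n * (\<Sum>j<n. \<Sum>i<n. (norm (b i j))\<^sup>2)\<^sup>2)"
    by (rule mult_left_mono, rule order_trans[OF rademacher_fourth_moment]) auto
  also have "\<dots> = 9 * 4 ^ n * (\<Sum>i<n. \<Sum>j<n. (norm (b i j))\<^sup>2)\<^sup>2"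
    by (subst sum.swap) (simp flip: power_mult_distrib)
  finally show ?thesis .
qed

text \<open>A Khinchine inequality with constant 1/3: a fourth moment of at most 9 times the squared
  second moment forces the first moment to be comparable with the root of the second.\<close>

lemma chaos_first_moment_ge:
  fixes b :: "nat \<Rightarrow> nat \<Rightarrow> 'a::real_inner"
  shows "4 ^ n * sqrt (\<Sum>i<n. \<Sum>j<n. (norm (b i j))\<^sup>2)
    \<le> 3 * (\<Sum>A\<in>Pow {..<n}. \<Sum>C\<in>Pow {..<n}. norm (chaos n A C b))"
proof (cases "(\<Sum>i<n. \<Sum>j<n. (norm (b i j))\<^sup>2) = 0")
  case True
  then show ?thesis by (simp add: sum_nonneg)
next
  case False
  define s where "s = sqrt (\<Sum>i<n. \<Sum>j<n. (norm (b i j))\<^sup>2)"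
  have s2: "s\<^sup>2 = (\<Sum>i<n. \<Sum>j<n. (norm (b i j))\<^sup>2)" by (simp add: s_def sum_nonneg)
  have s: "s > 0"
    using False by (simp add: s_def order.not_eq_order_implies_strict[OF not_sym] sum_nonneg)
  \<comment> \<open>Minorizing \<open>t\<close> by such a quartic turns the second and fourth moments into a bound for the first.\<close>
  have ineq: "27 * s\<^sup>2 * t\<^sup>2 - t ^ 4 \<le> 54 * s ^ 3 * t" if "t \<ge> 0" for t :: real
  proof -
    \<comment> \<open>The double root \<open>3 * s\<close> is the one that gets the best constant
      out of these moments, namely (27 - 9) / 54 = 1/3.\<close>
    have "0 \<le> t * ((t - 3 * s)\<^sup>2 * (t + 6 * s))"
      using that s by simp
    then show ?thesis by (simp add: power2_eq_square power3_eq_cube power4_eq_xxxx algebra_simps)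
  qed
  let ?E = "\<lambda>f. \<Sum>A\<in>Pow {..<n}. \<Sum>C\<in>Pow {..<n}. f (norm (chaos n A C b)) :: real"
  have "27 * s\<^sup>2 * (4 ^ n * s\<^sup>2) - 9 * 4 ^ n * (s\<^sup>2)\<^sup>2 \<le> 27 * s\<^sup>2 * ?E (\<lambda>t. t\<^sup>2) - ?E (\<lambda>t. t ^ 4)"
    using chaos_second_moment[of n b] chaos_fourth_moment[of n b] by (simp add: s2)
  also have "\<dots> = ?E (\<lambda>t. 27 * s\<^sup>2 * t\<^sup>2 - t ^ 4)"
    by (simp add: sum_distrib_left sum_subtractf)
  also have "\<dots> \<le> ?E (\<lambda>t. 54 * s ^ 3 * t)"
    by (intro sum_mono ineq) simp
  also have "\<dots> = 54 * s ^ 3 * ?E (\<lambda>t. t)" by (simp add: sum_distrib_left)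
  finally have "18 * s ^ 3 * (4 ^ n * s) \<le> 18 * s ^ 3 * (3 * ?E (\<lambda>t. t))"
    by (simp add: power2_eq_square power3_eq_cube algebra_simps)
  then show ?thesis using s by (simp add: s_def[symmetric] mult.commute)
qed

section \<open>Unconditional frames are Besselian\<close>

text \<open>Baire's theorem gives a closed level set containing a ball. Vectors of the ball are
  compared with its centre, which costs the factor 2 in the bound.\<close>

lemma banach_steinhaus:
  fixes T :: "'i \<Rightarrow> 'a::banach \<Rightarrow> 'b::real_normed_vector"
  assumes lin: "\<And>i. i \<in> I \<Longrightarrow> bounded_linear (T i)"
    and bdd: "\<And>x. \<exists>C. \<forall>i\<in>I. norm (T i x) \<le> C"
  obtains C where "C \<ge> 0" "\<And>i x. i \<in> I \<Longrightarrow> norm (T i x) \<le> C * norm x"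
proof -
  define S where "S n = {x. \<forall>i\<in>I. norm (T i x) \<le> real n}" for n :: nat
  have cl: "closed (S n)" for n
  proof -
    have "S n = (\<Inter>i\<in>I. {x. norm (T i x) \<le> real n})" by (auto simp: S_def)
    moreover have "closed {x. norm (T i x) \<le> real n}" if "i \<in> I" for i
      by (intro closed_Collect_le continuous_intros linear_continuous_on lin that)
    ultimately show ?thesis by auto
  qed
  have "\<Union>(range S) = UNIV"
  proof (rule set_eqI, simp)
    fix x
    obtain C where "\<forall>i\<in>I. norm (T i x) \<le> C" using bdd by blast
    moreover obtain n where "C \<le> real n" using real_arch_simple by blast
    ultimately show "\<exists>n. x \<in> S n" unfolding S_def by (blast intro: order_trans)
  qed
  moreover have "euclidean interior_of \<Union>(range S) = {}" if "\<And>n. interior (S n) = {}"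
    using cl that
    by (intro Baire_category_alt) (auto simp: completely_metrizable_space_euclidean)
  ultimately obtain n where "interior (S n) \<noteq> {}" by fastforce
  then obtain z where "z \<in> interior (S n)" by blast
  then obtain r where r: "r > 0" "cball z r \<subseteq> S n"
    by (meson mem_interior_cball)
  show thesis
  proof
    show "0 \<le> 2 * real n / r" using r by simp
    fix i x assume i: "i \<in> I"
    interpret bounded_linear "T i" by (rule lin[OF i])
    show "norm (T i x) \<le> 2 * real n / r * norm x"
    proof (cases "x = 0")
      case False
      define u where "u = (r / norm x) *\<^sub>R x"
      have "norm u = r" using False r by (simp add: u_def)
      then have "z + u \<in> S n" "z \<in> S n" using r by (auto simp: dist_norm)
      then have "norm (T i (z + u)) \<le> n" "norm (T i z) \<le> n" using i by (auto simp: S_def)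
      moreover have "T i u = T i (z + u) - T i z" by (simp add: add)
      ultimately have "norm (T i u) \<le> 2 * real n"
        using norm_triangle_ineq4[of "T i (z + u)" "T i z"] by simp
      moreover have "norm (T i u) = r / norm x * norm (T i x)"
        using r by (simp add: u_def scaleR)
      ultimately show ?thesis using r False by (simp add: field_simps)
    qed (simp add: zero)
  qed
qed

text \<open>
  If the sums over finite sets were unbounded, they would be so beyond any index; permuting each block
  of a suitable partition into intervals so that a bad finite set comes first gives a divergent
  rearrangement.
\<close>
lemma unconditionally_convergent_bounded:
  fixes f :: "nat \<Rightarrow> 'e::real_normed_vector"
  assumes "unconditionally_convergent f"
  shows "\<exists>C. \<forall>F. finite F \<longrightarrow> norm (sum f F) \<le> C"
proof (rule ccontr)
  assume unbdd: "\<not> ?thesis"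
  have tail: "\<exists>F M. finite F \<and> F \<subseteq> {N..<M} \<and> norm (sum f F) \<ge> 1 \<and> N < M" for N
  proof -
    \<comment> \<open>The threshold exceeds 1 by the most that indices below \<open>N\<close> can
      contribute, so at least 1 remains after they are removed.\<close>
    obtain F where F: "finite F" "norm (sum f F) > 1 + (\<Sum>n<N. norm (f n))"
      using unbdd by (meson not_le)
    let ?G = "F - {..<N}"
    have "sum f F = sum f ?G + sum f (F \<inter> {..<N})"
      using sum.Int_Diff[OF F(1), of f "{..<N}"] by simp
    moreover have "norm (sum f (F \<inter> {..<N})) \<le> (\<Sum>n<N. norm (f n))"
      by (rule norm_sum[THEN order_trans], rule sum_mono2) auto
    ultimately have "norm (sum f ?G) \<ge> 1"
      using F(2) norm_triangle_ineq[of "sum f ?G" "sum f (F \<inter> {..<N})"] by simp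
    moreover obtain M where "F \<subseteq> {..<M}" using finite_nat_iff_bounded F(1) by blast
    ultimately show ?thesis
      using F(1) by (intro exI[of _ ?G] exI[of _ "max M (Suc N)"]) auto
  qed
  then obtain G M where GM: "\<And>N. finite (G N)" "\<And>N. G N \<subseteq> {N..<M N}"
    "\<And>N. norm (sum f (G N)) \<ge> 1" "\<And>N. N < M N"
    by metis
  define K where "K k = (M ^^ k) 0" for k
  have K: "K 0 = 0" "K (Suc k) = M (K k)" for k by (simp_all add: K_def)
  have "strict_mono K" by (rule strict_mono_Suc_iff[THEN iffD2]) (simp add: K GM)
  let ?B = "\<lambda>k. {K k..<K (Suc k)}"
  have disj: "disjoint_family ?B"
    unfolding disjoint_family_on_def
  proof (intro ballI impI)
    fix k l :: nat assume "k \<noteq> l"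
    then have "K (Suc k) \<le> K l \<or> K (Suc l) \<le> K k"
      using strict_mono_leD[OF \<open>strict_mono K\<close>] by (meson Suc_leI nat_neq_iff)
    then show "?B k \<inter> ?B l = {}" by auto
  qed
  have cover: "\<exists>k. n \<in> ?B k" for n
  proof -
    have "\<exists>k. n < K k" using strict_mono_imp_increasing[OF \<open>strict_mono K\<close>, of "Suc n"]
      by (metis Suc_le_lessD)
    \<comment> \<open>The block of \<open>n\<close> ends at the first boundary beyond
      \<open>n\<close>; since \<open>K 0 = 0\<close>, that boundary has a predecessor.\<close>
    then have "n < K (LEAST k. n < K k)" by (rule LeastI_ex)
    moreover have "(LEAST k. n < K k) \<noteq> 0" using calculation K(1) by (metis not_less_zero)
    ultimately obtain k where k: "(LEAST k. n < K k) = Suc k" "n < K (Suc k)"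
      by (metis not0_implies_Suc)
    then have "\<not> n < K k" using not_less_Least[of k "\<lambda>k. n < K k"] by simp
    then show ?thesis using k by (intro exI[of _ k]) simp
  qed
  have Gsub: "G (K k) \<subseteq> ?B k" for k using GM(2)[of "K k"] by (simp add: K)
  have Gcard: "K k + card (G (K k)) \<le> K (Suc k)" for k
    using card_mono[OF _ Gsub, of k] GM(4)[of "K k"] by (simp add: K)
  have "\<exists>q. bij_betw q (?B k) (?B k) \<and> q ` {K k..<K k + card (G (K k))} = G (K k)" for k
  proof -
    let ?c = "K k + card (G (K k))"
    obtain q1 where q1: "bij_betw q1 {K k..<?c} (G (K k))"
      using GM(1)[of "K k"] bij_betw_iff_card by (metis card_atLeastLessThan diff_add_inverse finite_atLeastLessThan)
    have "card {?c..<K (Suc k)} = card (?B k - G (K k))"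
      using card_Diff_subset[OF GM(1) Gsub, of k] by simp
    then obtain q2 where q2: "bij_betw q2 {?c..<K (Suc k)} (?B k - G (K k))"
      using bij_betw_iff_card finite_atLeastLessThan finite_Diff by meson
    define q where "q n = (if n < ?c then q1 n else q2 n)" for n
    have b1: "bij_betw q {K k..<?c} (G (K k))"
      by (rule bij_betw_cong[THEN iffD1, OF _ q1]) (simp add: q_def)
    have "bij_betw q {?c..<K (Suc k)} (?B k - G (K k))"
      by (rule bij_betw_cong[THEN iffD1, OF _ q2]) (simp add: q_def)
    from bij_betw_combine[OF b1 this]
    have "bij_betw q ({K k..<?c} \<union> {?c..<K (Suc k)}) (G (K k) \<union> (?B k - G (K k)))"
      by blast
    moreover have "{K k..<?c} \<union> {?c..<K (Suc k)} = ?B k" using Gcard[of k] by auto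
    moreover have "G (K k) \<union> (?B k - G (K k)) = ?B k" using Gsub[of k] by blast
    ultimately show ?thesis using b1 by (auto simp: bij_betw_def)
  qed
  then obtain q where q: "\<And>k. bij_betw (q k) (?B k) (?B k)"
    "\<And>k. q k ` {K k..<K k + card (G (K k))} = G (K k)"
    by metis
  define p where "p n = q (THE k. n \<in> ?B k) n" for n
  have p: "p n = q k n" if "n \<in> ?B k" for n k
  proof -
    have "l = k" if "n \<in> ?B l" for l
      using disjoint_family_onD[OF disj, of k l] that \<open>n \<in> ?B k\<close> by blast
    with that have "(THE k. n \<in> ?B k) = k" by (rule the_equality)
    then show ?thesis by (simp add: p_def)
  qed
  have "bij_betw p (\<Union>k\<in>UNIV. ?B k) (\<Union>k\<in>UNIV. ?B k)"
  proof (rule bij_betw_UNION_disjoint[OF disj])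
    fix k
    have "bij_betw p (?B k) (?B k) = bij_betw (q k) (?B k) (?B k)"
      by (rule bij_betw_cong) (rule p)
    then show "bij_betw p (?B k) (?B k)" using q(1) by blast
  qed
  moreover have "(\<Union>k\<in>UNIV. ?B k) = UNIV" using cover by blast
  ultimately have bij: "bij p" by simp
  then have "summable (\<lambda>n. f (p n))" using assms by (simp add: unconditionally_convergent_def)
  then have "Cauchy (\<lambda>n. \<Sum>i<n. f (p i))"
    by (simp add: summable_iff_convergent convergent_Cauchy)
  then obtain N where N: "\<And>m n. m \<ge> N \<Longrightarrow> n \<ge> N \<Longrightarrow> norm ((\<Sum>i<m. f (p i)) - (\<Sum>i<n. f (p i))) < 1"
    using CauchyD[of _ 1] by (metis zero_less_one)
  \<comment> \<open>Since \<open>N \<le> K N\<close>, the partial sums up to \<open>?a\<close> and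
    \<open>?c\<close> lie beyond the Cauchy threshold, yet they differ by the sum over
    \<open>G (K N)\<close>, of norm at least 1.\<close>
  let ?a = "K N" and ?c = "K N + card (G (K N))"
  have "N \<le> K N" by (rule strict_mono_imp_increasing[OF \<open>strict_mono K\<close>])
  then have "norm ((\<Sum>i<?c. f (p i)) - (\<Sum>i<?a. f (p i))) < 1" by (intro N) auto
  moreover have "(\<Sum>i<?c. f (p i)) - (\<Sum>i<?a. f (p i)) = sum (\<lambda>i. f (p i)) {?a..<?c}"
    using sum_diff_nat_ivl[of 0 ?a ?c "\<lambda>i. f (p i)"] by (simp add: atLeast0LessThan)
  moreover have "\<dots> = sum f (p ` {?a..<?c})"
    using bij by (simp add: sum.reindex inj_on_def bij_def)
  moreover have "p ` {?a..<?c} = G (K N)"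
  proof -
    have "p n = q N n" if "n \<in> {?a..<?c}" for n
      using that Gcard[of N] by (intro p) auto
    then show ?thesis using q(2)[of N] by simp
  qed
  ultimately show False using GM(3)[of "K N"] by simp
qed

text \<open>In each real coordinate the nonnegative and the negative terms form two subset sums,
  each bounded by \<open>C\<close>, whence the factor 2; adding up the coordinates gives the
  dimension.\<close>

lemma sum_norm_le_of_partial_sums:
  fixes z :: "'i \<Rightarrow> 'k::euclidean_space"
  assumes "finite I" and F: "\<And>F. F \<subseteq> I \<Longrightarrow> norm (sum z F) \<le> C"
  shows "(\<Sum>i\<in>I. norm (z i)) \<le> 2 * real DIM('k) * C"
proof -
  have coord: "(\<Sum>i\<in>I. \<bar>z i \<bullet> u\<bar>) \<le> 2 * C" if u: "u \<in> Basis" for u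
  proof -
    let ?P = "{i\<in>I. z i \<bullet> u \<ge> 0}" and ?N = "{i\<in>I. \<not> z i \<bullet> u \<ge> 0}"
    have "(\<Sum>i\<in>I. \<bar>z i \<bullet> u\<bar>) = (\<Sum>i\<in>?P. \<bar>z i \<bullet> u\<bar>) + (\<Sum>i\<in>?N. \<bar>z i \<bullet> u\<bar>)"
      using assms(1) by (subst sum.union_disjoint[symmetric]) (auto intro!: sum.cong)
    also have "\<dots> = sum z ?P \<bullet> u - sum z ?N \<bullet> u"
      by (simp add: inner_sum_left sum_negf[symmetric])
    also have "\<dots> \<le> C + C"
      using Basis_le_norm[OF u, of "sum z ?P"] Basis_le_norm[OF u, of "sum z ?N"] F[of ?P] F[of ?N]
      by auto
    finally show ?thesis by simp
  qed
  have "(\<Sum>i\<in>I. norm (z i)) \<le> (\<Sum>i\<in>I. \<Sum>u\<in>Basis. \<bar>z i \<bullet> u\<bar>)"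
    by (intro sum_mono norm_le_l1)
  also have "\<dots> = (\<Sum>u\<in>Basis. \<Sum>i\<in>I. \<bar>z i \<bullet> u\<bar>)" by (rule sum.swap)
  also have "\<dots> \<le> (\<Sum>u\<in>(Basis::'k set). 2 * C)" by (intro sum_mono coord)
  finally show ?thesis by simp
qed

text \<open>The finite partial sum operators are pointwise bounded, hence uniformly bounded. A
  functional \<open>y\<close> turns this into a bound for all finite subset sums of the scalars
  \<open>b n x * y (a n)\<close>, and so for the sums of their norms.\<close>

lemma unconditional_imp_besselian:
  fixes smul :: "'k::{real_normed_field,euclidean_space} \<Rightarrow> 'e::banach \<Rightarrow> 'e"
  assumes bl: "\<And>x. bounded_linear (\<lambda>c. smul c x)"
    and frame: "unconditional_schauder_frame smul a b"
  shows "besselian_schauder_frame smul a b"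
proof -
  have sf: "schauder_frame smul a b"
    and uc: "\<And>x. unconditionally_convergent (\<lambda>n. smul (b n x) (a n))"
    using frame by (auto simp: unconditional_schauder_frame_def)
  have bbl: "bounded_linear (b n)" for n
    using sf by (auto simp: schauder_frame_def dual_def)
  obtain C where C: "C \<ge> 0"
    "\<And>F x. F \<in> {F. finite F} \<Longrightarrow> norm (\<Sum>n\<in>F. smul (b n x) (a n)) \<le> C * norm x"
  proof (rule banach_steinhaus[where I = "{F. finite F}" and T = "\<lambda>F x. \<Sum>n\<in>F. smul (b n x) (a n)"])
    show "bounded_linear (\<lambda>x. \<Sum>n\<in>F. smul (b n x) (a n))" for F
      by (intro bounded_linear_sum bounded_linear_compose[OF bl bbl])
    show "\<exists>C. \<forall>F\<in>{F. finite F}. norm (\<Sum>n\<in>F. smul (b n x) (a n)) \<le> C" for x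
      using unconditionally_convergent_bounded[OF uc[of x]] by simp
  qed blast
  \<comment> \<open>Adding 1 keeps \<open>B\<close> positive even if \<open>C = 0\<close>.\<close>
  define B where "B = 2 * real DIM('k) * C + 1"
  have "summable (\<lambda>n. norm (b n x) * norm (y (a n))) \<and>
      (\<Sum>n. norm (b n x) * norm (y (a n))) \<le> B * norm x * onorm y"
    if y: "y \<in> dual smul" for x y
  proof -
    have ybl: "bounded_linear y" and ylin: "y (smul c v) = c * y v" for c v
      using y by (auto simp: dual_def Vector_Spaces.linear_def module_hom_def module_hom_axioms_def)
    have bd: "(\<Sum>n<N. norm (b n x) * norm (y (a n))) \<le> B * norm x * onorm y" for N
    proof -
      have "(\<Sum>n<N. norm (b n x * y (a n))) \<le> 2 * real DIM('k) * (onorm y * (C * norm x))"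
      proof (rule sum_norm_le_of_partial_sums)
        fix F assume "F \<subseteq> {..<N}"
        then have "finite F" by (rule finite_subset) simp
        have "(\<Sum>n\<in>F. b n x * y (a n)) = y (\<Sum>n\<in>F. smul (b n x) (a n))"
          using bounded_linear.linear[OF ybl] by (simp add: linear_sum ylin)
        also have "norm \<dots> \<le> onorm y * norm (\<Sum>n\<in>F. smul (b n x) (a n))"
          by (rule onorm[OF ybl])
        also have "\<dots> \<le> onorm y * (C * norm x)"
          using C(2) \<open>finite F\<close> by (intro mult_left_mono onorm_pos_le ybl) auto
        finally show "norm (\<Sum>n\<in>F. b n x * y (a n)) \<le> onorm y * (C * norm x)" .
      qed simp
      also have "\<dots> \<le> B * norm x * onorm y"
        using onorm_pos_le[OF ybl] by (simp add: B_def algebra_simps)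
      finally show ?thesis by (simp add: norm_mult)
    qed
    then show ?thesis
      by (auto intro!: summableI_nonneg_bounded[OF _ bd] suminf_le_const[OF _ bd])
  qed
  moreover have "B > 0" using C by (simp add: B_def add_nonneg_pos)
  ultimately show ?thesis using sf by (auto simp: besselian_schauder_frame_def)
qed

section \<open>Sign-averaged test operators and functionals\<close>

lemma chaos_linear:
  assumes "linear f"
  shows "f (chaos n A C b) = chaos n A C (\<lambda>i j. f (b i j))"
  using assms by (simp add: chaos_def linear_sum linear_scale)

lemma sum_lessThan_add:
  fixes f :: "nat \<Rightarrow> 'b::comm_monoid_add"
  shows "(\<Sum>i<n + k. f i) = (\<Sum>i<n. f i) + (\<Sum>i<k. f (n + i))"
  by (induction k) (simp_all add: add.assoc)

text \<open>Sylvester's recursive Hadamard matrix, used at indices below \<open>2 ^ m\<close>; the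
  remainders give the position inside a quarter block.\<close>

primrec hadamard :: "nat \<Rightarrow> nat \<Rightarrow> nat \<Rightarrow> real" where
  "hadamard 0 i j = 1"
| "hadamard (Suc m) i j =
     (if 2 ^ m \<le> i \<and> 2 ^ m \<le> j then -1 else 1) * hadamard m (i mod 2 ^ m) (j mod 2 ^ m)"

lemma abs_hadamard [simp]: "\<bar>hadamard m i j\<bar> = 1"
  by (induction m arbitrary: i j) (simp_all add: abs_mult)

text \<open>Up to the factor \<open>sqrt (2 ^ m)\<close> the matrix is an isometry. If
  \<open>u\<close> and \<open>w\<close> are the images of the two halves of \<open>x\<close>, the
  halves of the new image are \<open>u + w\<close> and \<open>u - w\<close>, and the parallelogram
  law supplies the extra factor 2.\<close>

lemma norm_hadamard_apply:
  fixes x :: "nat \<Rightarrow> 'a::real_inner"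
  shows "(\<Sum>i<2 ^ m. (norm (\<Sum>j<2 ^ m. hadamard m i j *\<^sub>R x j))\<^sup>2) = 2 ^ m * (\<Sum>j<2 ^ m. (norm (x j))\<^sup>2)"
proof (induction m arbitrary: x)
  case (Suc m)
  let ?n = "2 ^ m :: nat"
  let ?u = "\<lambda>i. \<Sum>j<?n. hadamard m i j *\<^sub>R x j"
  let ?w = "\<lambda>i. \<Sum>j<?n. hadamard m i j *\<^sub>R x (?n + j)"
  let ?y = "\<lambda>i. \<Sum>j<2 ^ Suc m. hadamard (Suc m) i j *\<^sub>R x j"
  have two: "(2::nat) ^ Suc m = ?n + ?n" by simp
  have top: "?y i = ?u i + ?w i" and bot: "?y (?n + i) = ?u i - ?w i" if "i < ?n" for i
    unfolding two sum_lessThan_add using that by (simp_all add: sum_negf)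
  have "(\<Sum>i<2 ^ Suc m. (norm (?y i))\<^sup>2) = (\<Sum>i<?n. (norm (?y i))\<^sup>2) + (\<Sum>i<?n. (norm (?y (?n + i)))\<^sup>2)"
    by (subst (1) two) (rule sum_lessThan_add)
  also have "\<dots> = (\<Sum>i<?n. (norm (?u i + ?w i))\<^sup>2 + (norm (?u i - ?w i))\<^sup>2)"
    unfolding sum.distrib by (intro arg_cong2[where f = "(+)"] sum.cong refl) (simp_all only: top bot lessThan_iff)
  also have "\<dots> = (\<Sum>i<?n. 2 * (norm (?u i))\<^sup>2 + 2 * (norm (?w i))\<^sup>2)"
    by (intro sum.cong refl) (simp add: power2_norm_eq_inner inner_add inner_diff inner_commute)
  also have "\<dots> = 2 ^ Suc m * ((\<Sum>j<?n. (norm (x j))\<^sup>2) + (\<Sum>j<?n. (norm (x (?n + j)))\<^sup>2))"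
    using Suc[of x] Suc[of "\<lambda>j. x (?n + j)"]
    by (simp add: sum.distrib algebra_simps flip: sum_distrib_left)
  also have "\<dots> = 2 ^ Suc m * (\<Sum>j<2 ^ Suc m. (norm (x j))\<^sup>2)"
    unfolding two sum_lessThan_add ..
  finally show ?case .
qed simp

section \<open>Unit vectors, matrix units and the signed Hadamard operators\<close>

lift_definition unit_ell2 :: "nat \<Rightarrow> 'k::{real_normed_field,banach} ell2" is "\<lambda>i j. of_bool (j = i)"
  by (rule summable_finite[where N = "{i}" for i]) auto

lemma bounded_linear_ell2_nth: "bounded_linear (\<lambda>x. ell2_nth x i)"
  by (rule bounded_linear_intro[where K = 1])
    (simp_all add: plus_ell2.rep_eq scaleR_ell2.rep_eq norm_ell2_nth_le)

lemma norm_ell2_eq_L2_set: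
  assumes "\<And>i. i \<ge> n \<Longrightarrow> ell2_nth x i = 0"
  shows "norm x = L2_set (\<lambda>i. norm (ell2_nth x i)) {..<n}"
proof -
  have "(\<Sum>i. (norm (ell2_nth x i))\<^sup>2) = (\<Sum>i<n. (norm (ell2_nth x i))\<^sup>2)"
    using assms by (intro suminf_finite) auto
  then show ?thesis by (simp add: norm_ell2.rep_eq L2_set_def)
qed

lemma norm_unit_ell2 [simp]: "norm (unit_ell2 i) = 1"
proof -
  have "(\<Sum>j. (norm (ell2_nth (unit_ell2 i :: 'a ell2) j))\<^sup>2) = (\<Sum>j\<in>{i}. (norm (ell2_nth (unit_ell2 i :: 'a ell2) j))\<^sup>2)"
    by (intro suminf_finite) (auto simp: unit_ell2.rep_eq)
  then show ?thesis by (simp add: norm_ell2.rep_eq unit_ell2.rep_eq)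
qed

lemma bounded_linear_scale_ell2_left: "bounded_linear (\<lambda>c. scale_ell2 c x)"
  by (rule bounded_linear_intro[where K = "norm x"])
    (simp add: module.scale_left_distrib[OF vector_space_ell2[folded module_iff_vector_space]],
     transfer, simp, simp add: norm_scale_ell2)

definition matrix_unit :: "nat \<Rightarrow> nat \<Rightarrow> 'k::{real_normed_field,euclidean_space} compact_ell2" where
  "matrix_unit i j = Abs_compact_ell2 (Blinfun (\<lambda>v. scale_ell2 (ell2_nth v j) (unit_ell2 i)))"

text \<open>\<open>Abs_compact_ell2\<close> is legitimate here because the operator has rank one:
  the unit ball is mapped into the image of the scalar ball, which is compact as the scalar field is
  Euclidean.\<close>

lemma matrix_unit_apply:
  "blinfun_of_compact (matrix_unit i j) v = scale_ell2 (ell2_nth v j) (unit_ell2 i)"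
proof -
  let ?T = "\<lambda>v::'a ell2. scale_ell2 (ell2_nth v j) (unit_ell2 i)"
  have T: "blinfun_apply (Blinfun ?T) = ?T"
    by (rule bounded_linear_Blinfun_apply)
      (rule bounded_linear_compose[OF bounded_linear_scale_ell2_left bounded_linear_ell2_nth])
  have "?T ` cball 0 1 \<subseteq> (\<lambda>c. scale_ell2 c (unit_ell2 i)) ` cball 0 1"
    using norm_ell2_nth_le by (force intro: order_trans)
  moreover have "compact ((\<lambda>c. scale_ell2 c (unit_ell2 i :: 'a ell2)) ` cball 0 1)"
    by (intro compact_continuous_image linear_continuous_on bounded_linear_scale_ell2_left) simp
  ultimately have "compact (closure (?T ` cball 0 1))"
    by (rule compact_closure_subset[rotated])
  moreover have "?T (scale_ell2 c v) = scale_ell2 c (?T v)" for c v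
    by (simp add: scale_ell2.rep_eq module.scale_scale[OF vector_space_ell2[folded module_iff_vector_space]])
  ultimately have "compact_operator scale_ell2 scale_ell2 (blinfun_apply (Blinfun ?T))"
    by (subst compact_operator_ell2_iff) (simp add: T)
  then show ?thesis by (simp add: matrix_unit_def Abs_compact_ell2_inverse T)
qed

lemma norm_compact_ell2_apply: "norm (blinfun_of_compact T v) \<le> norm T * norm v"
  unfolding norm_compact_ell2.rep_eq by (rule norm_blinfun)

lemma bounded_linear_compact_ell2_apply: "bounded_linear (\<lambda>T. blinfun_of_compact T v)"
  by (rule bounded_linear_intro[where K = "norm v"])
    (simp_all add: plus_compact_ell2.rep_eq scaleR_compact_ell2.rep_eq blinfun.add_left
      blinfun.scaleR_left norm_compact_ell2_apply)

text \<open>The operator is the Hadamard corner multiplied on both sides by diagonal sign matrices,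
  which preserve norms. Thus \<open>sqrt n\<close> bounds it for every choice of signs, whereas the
  all-ones matrix would give norm \<open>n\<close>.\<close>

lemma norm_chaos_hadamard_le:
  fixes m :: nat and A C :: "nat set"
  defines "n \<equiv> 2 ^ m"
  shows "norm (chaos n A C (\<lambda>i j. hadamard m i j *\<^sub>R matrix_unit i j)
    :: 'k::{real_normed_field,euclidean_space} compact_ell2) \<le> sqrt n"
proof -
  let ?X = "chaos n A C (\<lambda>i j. hadamard m i j *\<^sub>R matrix_unit i j) :: 'k compact_ell2"
  have "norm (blinfun_of_compact ?X v) \<le> sqrt n * norm v" for v
  proof -
    have nth: "ell2_nth (blinfun_of_compact ?X v) k =
       (\<Sum>i<n. if k = i then sgn_of A k *\<^sub>R (\<Sum>j<n. hadamard m k j *\<^sub>R (sgn_of C j *\<^sub>R ell2_nth v j)) else 0)" for k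
    proof -
      have lin: "linear (\<lambda>T. ell2_nth (blinfun_of_compact T v) k)"
        by (rule bounded_linear.linear)
          (rule bounded_linear_compose[OF bounded_linear_ell2_nth bounded_linear_compact_ell2_apply])
      have "ell2_nth (blinfun_of_compact ?X v) k
          = chaos n A C (\<lambda>i j. hadamard m i j *\<^sub>R (ell2_nth v j * of_bool (k = i)))"
        by (subst chaos_linear[OF lin]) (simp add: scaleR_compact_ell2.rep_eq blinfun.scaleR_left matrix_unit_apply
            scaleR_ell2.rep_eq scale_ell2.rep_eq unit_ell2.rep_eq)
      also have "\<dots> = (\<Sum>i<n. if k = i then sgn_of A k *\<^sub>R (\<Sum>j<n. hadamard m k j *\<^sub>R (sgn_of C j *\<^sub>R ell2_nth v j)) else 0)"
        unfolding chaos_def by (rule sum.cong[OF refl]) (simp add: mult.commute)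
      finally show ?thesis .
    qed
    have "norm (blinfun_of_compact ?X v) = L2_set (\<lambda>i. norm (ell2_nth (blinfun_of_compact ?X v) i)) {..<n}"
      by (rule norm_ell2_eq_L2_set) (simp add: nth)
    also have "\<dots> = sqrt (\<Sum>i<n. (norm (\<Sum>j<n. hadamard m i j *\<^sub>R (sgn_of C j *\<^sub>R ell2_nth v j)))\<^sup>2)"
      unfolding L2_set_def by (intro arg_cong[where f = sqrt] sum.cong refl) (simp add: nth)
    also have "\<dots> = sqrt (n * (\<Sum>j<n. (norm (ell2_nth v j))\<^sup>2))"
      unfolding n_def norm_hadamard_apply by simp
    also have "\<dots> = sqrt n * L2_set (\<lambda>j. norm (ell2_nth v j)) {..<n}"
      by (simp add: L2_set_def real_sqrt_mult)
    also have "\<dots> \<le> sqrt n * norm v"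
      by (intro mult_left_mono L2_set_le_norm_ell2) simp
    finally show ?thesis .
  qed
  then show ?thesis
    unfolding norm_compact_ell2.rep_eq by (intro norm_blinfun_bound) simp
qed

section \<open>Matrix entries and the test functionals\<close>

definition entry :: "nat \<Rightarrow> nat \<Rightarrow> 'k::{real_normed_field,banach} compact_ell2 \<Rightarrow> 'k" where
  "entry i j T = ell2_nth (blinfun_of_compact T (unit_ell2 j)) i"

lemma bounded_linear_entry: "bounded_linear (entry i j)"
  unfolding entry_def
  by (rule bounded_linear_compose[OF bounded_linear_ell2_nth bounded_linear_compact_ell2_apply])

lemma entry_scale: "entry i j (scale_compact c T) = c * entry i j T"
  by (simp add: entry_def scale_compact_apply scale_ell2.rep_eq)

lemma entry_matrix_unit: "entry i j (matrix_unit i j) = 1"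
  by (simp add: entry_def matrix_unit_apply scale_ell2.rep_eq unit_ell2.rep_eq)

lemma chaos_entry_in_dual:
  "(\<lambda>T. chaos n A C (\<lambda>i j. entry i j T)) \<in> dual scale_compact"
proof -
  let ?y = "\<lambda>T. chaos n A C (\<lambda>i j. entry i j T) :: 'a"
  have bl: "bounded_linear ?y"
    unfolding chaos_def
    by (intro bounded_linear_sum bounded_linear_compose[OF bounded_linear_scaleR_right] bounded_linear_entry)
  have "?y (scale_compact c T) = c * ?y T" for c T
    by (simp add: entry_scale chaos_linear[OF bounded_linear.linear[OF bounded_linear_mult_right[of c]]])
  moreover have "vector_space ((*) :: 'a \<Rightarrow> 'a \<Rightarrow> 'a)"
    by standard (simp_all add: algebra_simps)
  ultimately have "Vector_Spaces.linear scale_compact (*) ?y"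
    using vector_space_compact_ell2[where 'a = 'a] linear_add[OF bounded_linear.linear[OF bl]]
    by (simp add: Vector_Spaces.linear_def module_hom_def module_hom_axioms_def
        module_iff_vector_space)
  with bl show ?thesis by (simp add: dual_def)
qed

text \<open>The functional pairs the image of one sign vector under \<open>T\<close> with another
  sign vector; each of the two has norm \<open>sqrt n\<close>.\<close>

lemma onorm_chaos_entry_le:
  "onorm (\<lambda>T. chaos n A C (\<lambda>i j. entry i j T) :: 'k::{real_normed_field,banach}) \<le> n"
proof (rule onorm_bound)
  fix T :: "'k compact_ell2"
  define \<xi> where "\<xi> = (\<Sum>j<n. sgn_of C j *\<^sub>R unit_ell2 j :: 'k ell2)"
  let ?w = "blinfun_of_compact T \<xi>"
  have nth_xi: "ell2_nth \<xi> k = (if k < n then of_real (sgn_of C k) else 0)" for k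
  proof -
    have "ell2_nth \<xi> k = (\<Sum>j<n. if j = k then of_real (sgn_of C k) else 0)"
      unfolding \<xi>_def linear_sum[OF bounded_linear.linear[OF bounded_linear_ell2_nth]]
      by (rule sum.cong[OF refl]) (simp add: scaleR_ell2.rep_eq unit_ell2.rep_eq of_real_def)
    then show ?thesis by simp
  qed
  have norm_xi: "norm \<xi> = sqrt n"
    by (subst norm_ell2_eq_L2_set[where n = n]) (simp_all add: nth_xi L2_set_def)
  have lin: "linear (\<lambda>v. ell2_nth (blinfun_of_compact T v) i)" for i
    by (rule bounded_linear.linear)
      (rule bounded_linear_compose[OF bounded_linear_ell2_nth blinfun.bounded_linear_right])
  have "chaos n A C (\<lambda>i j. entry i j T) = (\<Sum>i<n. sgn_of A i *\<^sub>R ell2_nth ?w i)"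
    by (simp add: chaos_def entry_def \<xi>_def linear_sum[OF lin] linear_scale[OF lin])
  also have "norm \<dots> \<le> (\<Sum>i<n. \<bar>1\<bar> * \<bar>norm (ell2_nth ?w i)\<bar>)"
    by (rule order_trans[OF norm_sum]) simp
  also have "\<dots> \<le> L2_set (\<lambda>i. 1) {..<n} * L2_set (\<lambda>i. norm (ell2_nth ?w i)) {..<n}"
    by (rule L2_set_mult_ineq)
  also have "\<dots> \<le> sqrt n * (norm T * sqrt n)"
    using order_trans[OF L2_set_le_norm_ell2[of ?w n] norm_compact_ell2_apply[of T \<xi>]]
    by (simp add: L2_set_def[of "\<lambda>i. 1"] mult_left_mono norm_xi)
  finally show "norm (chaos n A C (\<lambda>i j. entry i j T)) \<le> n * norm T"
    by (simp add: mult.commute[of "norm T"] flip: mult.assoc)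
qed simp

section \<open>The trace of the identity on the n x n corner, bounded from both sides\<close>

lemma sum_product_le_of_pointwise:
  fixes X :: "'k \<Rightarrow> 'p \<Rightarrow> real" and Y :: "'k \<Rightarrow> 'q \<Rightarrow> real" and D :: real
  assumes "\<And>p q. p \<in> P \<Longrightarrow> q \<in> Q \<Longrightarrow> (\<Sum>k\<in>K. X k p * Y k q) \<le> D"
  shows "(\<Sum>k\<in>K. (\<Sum>p\<in>P. X k p) * (\<Sum>q\<in>Q. Y k q)) \<le> real (card P) * real (card Q) * D"
proof -
  \<comment> \<open>Expanding the product leaves one instance of the assumption for each pair
    \<open>p\<close>, \<open>q\<close>, so test operators and functionals are averaged
    independently.\<close>
  have "(\<Sum>k\<in>K. (\<Sum>p\<in>P. X k p) * (\<Sum>q\<in>Q. Y k q)) = (\<Sum>p\<in>P. \<Sum>q\<in>Q. \<Sum>k\<in>K. X k p * Y k q)"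
    by (simp add: sum_product sum.swap[of _ K])
  also have "\<dots> \<le> (\<Sum>p\<in>P. \<Sum>q\<in>Q. D)" by (intro sum_mono assms)
  finally show ?thesis by simp
qed

lemma no_besselian_schauder_frame:
  fixes a :: "nat \<Rightarrow> 'k::{real_normed_field,euclidean_space} compact_ell2"
  shows "\<not> besselian_schauder_frame scale_compact a b"
proof
  assume "besselian_schauder_frame scale_compact a b"
  then have sf: "schauder_frame scale_compact a b"
    and "\<exists>B>0. \<forall>x. \<forall>y\<in>dual scale_compact. summable (\<lambda>k. norm (b k x) * norm (y (a k))) \<and>
        (\<Sum>k. norm (b k x) * norm (y (a k))) \<le> B * norm x * onorm y"
    by (simp_all only: besselian_schauder_frame_def)
  then obtain B where B: "B > 0"
    and all: "\<forall>x. \<forall>y\<in>dual scale_compact. summable (\<lambda>k. norm (b k x) * norm (y (a k))) \<and>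
        (\<Sum>k. norm (b k x) * norm (y (a k))) \<le> B * norm x * onorm y"
    by (elim exE conjE)
  have summ: "summable (\<lambda>k. norm (b k x) * norm (y (a k)))"
    and bound: "(\<Sum>k. norm (b k x) * norm (y (a k))) \<le> B * norm x * onorm y"
    if "y \<in> dual scale_compact" for x y
    using all[rule_format, OF that, of x] by simp_all
  have lin_b: "linear (b k)" for k
    using sf by (auto simp: schauder_frame_def dual_def bounded_linear.linear)
  \<comment> \<open>The argument ends in \<open>sqrt n \<le> 9 * B\<close> for
    \<open>n = 2 ^ m\<close>, which this \<open>m\<close> violates. The 9 is the product of two
    Khinchine factors 3.\<close>
  obtain m :: nat where m: "(9 * B)\<^sup>2 < 2 ^ m"
    using real_arch_pow[of 2 "(9 * B)\<^sup>2"] by auto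
  define n :: nat where "n = 2 ^ m"
  have n: "n > 0" by (simp add: n_def)
  let ?P = "Pow {..<n} \<times> Pow {..<n}"
  define \<beta> where "\<beta> k = sqrt (\<Sum>i<n. \<Sum>j<n. (norm (b k (matrix_unit i j)))\<^sup>2)" for k
  define \<alpha> where "\<alpha> k = sqrt (\<Sum>i<n. \<Sum>j<n. (norm (entry i j (a k)))\<^sup>2)" for k
  define X where "X = (\<lambda>(A, C). chaos n A C (\<lambda>i j. hadamard m i j *\<^sub>R matrix_unit i j) :: 'k compact_ell2)"
  define Y where "Y = (\<lambda>(A, C) T. chaos n A C (\<lambda>i j. entry i j T) :: 'k)"
  \<comment> \<open>The Hadamard entries have modulus 1, so they leave the Hilbert-Schmidt norm
    \<open>\<beta> k\<close> unchanged while keeping the norm of \<open>X p\<close> small.\<close>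
  have Xb: "4 ^ n * \<beta> k \<le> 3 * (\<Sum>p\<in>?P. norm (b k (X p)))" for k
    using chaos_first_moment_ge[of n "\<lambda>i j. hadamard m i j *\<^sub>R b k (matrix_unit i j)"]
    by (simp add: X_def \<beta>_def chaos_linear[OF lin_b] linear_scale[OF lin_b]
        sum.cartesian_product case_prod_unfold)
  have Ya: "4 ^ n * \<alpha> k \<le> 3 * (\<Sum>q\<in>?P. norm (Y q (a k)))" for k
    using chaos_first_moment_ge[of n "\<lambda>i j. entry i j (a k)"]
    by (simp add: Y_def \<alpha>_def sum.cartesian_product case_prod_unfold)
  have XY: "(\<Sum>k<N. norm (b k (X p)) * norm (Y q (a k))) \<le> B * sqrt n * n" for N p q
  proof -
    have Y: "Y q \<in> dual scale_compact" by (simp add: Y_def case_prod_unfold chaos_entry_in_dual)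
    have "(\<Sum>k<N. norm (b k (X p)) * norm (Y q (a k))) \<le> (\<Sum>k. norm (b k (X p)) * norm (Y q (a k)))"
      by (rule sum_le_suminf[OF summ[OF Y]]) auto
    also have "\<dots> \<le> B * norm (X p) * onorm (Y q)" by (rule bound[OF Y])
    also have "\<dots> \<le> B * sqrt n * n"
    proof (intro mult_mono)
      show "norm (X p) \<le> sqrt n"
        unfolding X_def n_def case_prod_unfold by (rule norm_chaos_hadamard_le)
      show "onorm (Y q) \<le> n"
        unfolding Y_def case_prod_unfold by (rule onorm_chaos_entry_le)
      show "0 \<le> onorm (Y q)" using Y by (simp add: dual_def onorm_pos_le)
    qed (use B in auto)
    finally show ?thesis .
  qed
  \<comment> \<open>\<open>?P\<close> has \<open>4 ^ n\<close> elements, so the averaging factors on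
    the two sides cancel.\<close>
  have upper: "(\<Sum>k<N. \<beta> k * \<alpha> k) \<le> 9 * (B * sqrt n * n)" for N
  proof -
    have "(4 ^ n * 4 ^ n) * (\<Sum>k<N. \<beta> k * \<alpha> k) = (\<Sum>k<N. (4 ^ n * \<beta> k) * (4 ^ n * \<alpha> k))"
      by (simp add: sum_distrib_left mult_ac)
    also have "\<dots> \<le> (\<Sum>k<N. (3 * (\<Sum>p\<in>?P. norm (b k (X p)))) * (3 * (\<Sum>q\<in>?P. norm (Y q (a k)))))"
      by (intro sum_mono mult_mono Xb Ya mult_nonneg_nonneg sum_nonneg) (auto simp: \<alpha>_def sum_nonneg)
    also have "\<dots> = 9 * (\<Sum>k<N. (\<Sum>p\<in>?P. norm (b k (X p))) * (\<Sum>q\<in>?P. norm (Y q (a k))))"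
      unfolding sum_distrib_left[of 9] by (intro sum.cong refl) simp
    also have "\<dots> \<le> 9 * (real (card ?P) * real (card ?P) * (B * sqrt n * n))"
      by (rule mult_left_mono[OF sum_product_le_of_pointwise[OF XY]]) simp
    also have "\<dots> = (4 ^ n * 4 ^ n) * (9 * (B * sqrt n * n))"
      by (simp add: card_cartesian_product card_Pow flip: power_mult_distrib)
    finally show ?thesis by simp
  qed
  \<comment> \<open>The sum is the trace, on the corner, of the rank-one map sending
    \<open>x\<close> to the \<open>k\<close>-th frame term; Cauchy-Schwarz over the index pairs
    bounds it.\<close>
  have trace: "norm (\<Sum>i<n. \<Sum>j<n. b k (matrix_unit i j) * entry i j (a k)) \<le> \<beta> k * \<alpha> k" for k
  proof -
    let ?I = "{..<n} \<times> {..<n}"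
    have "norm (\<Sum>i<n. \<Sum>j<n. b k (matrix_unit i j) * entry i j (a k))
        \<le> (\<Sum>(i, j)\<in>?I. \<bar>norm (b k (matrix_unit i j))\<bar> * \<bar>norm (entry i j (a k))\<bar>)"
      unfolding sum.cartesian_product
      by (rule order_trans[OF norm_sum]) (simp add: norm_mult case_prod_unfold)
    also have "\<dots> \<le> L2_set (\<lambda>(i, j). norm (b k (matrix_unit i j))) ?I * L2_set (\<lambda>(i, j). norm (entry i j (a k))) ?I"
      unfolding case_prod_unfold by (rule L2_set_mult_ineq)
    also have "\<dots> = \<beta> k * \<alpha> k"
      by (simp add: L2_set_def \<alpha>_def \<beta>_def sum.cartesian_product case_prod_unfold)
    finally show ?thesis .
  qed
  \<comment> \<open>Reading off one entry in the frame expansion of the matching matrix unit gives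
    1; adding over all pairs produces the trace \<open>n * n\<close>.\<close>
  have "(\<lambda>k. b k (matrix_unit i j) * entry i j (a k)) sums 1" for i j
  proof -
    have "(\<lambda>k. scale_compact (b k (matrix_unit i j)) (a k)) sums matrix_unit i j"
      using sf by (simp add: schauder_frame_def)
    from bounded_linear.sums[OF bounded_linear_entry this, of i j]
    show ?thesis by (simp add: entry_scale entry_matrix_unit)
  qed
  then have "(\<lambda>k. \<Sum>i<n. \<Sum>j<n. b k (matrix_unit i j) * entry i j (a k)) sums (\<Sum>i<n. \<Sum>j<n. 1)"
    by (intro sums_sum)
  then have "(\<lambda>N. \<Sum>k<N. \<Sum>i<n. \<Sum>j<n. b k (matrix_unit i j) * entry i j (a k)) \<longlonglongrightarrow> of_nat (n * n)"
    by (simp add: sums_def)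
  then have "(\<lambda>N. norm (\<Sum>k<N. \<Sum>i<n. \<Sum>j<n. b k (matrix_unit i j) * entry i j (a k)))
      \<longlonglongrightarrow> norm (of_nat (n * n) :: 'k)"
    by (rule tendsto_norm)
  then have "norm (of_nat (n * n) :: 'k) \<le> 9 * (B * sqrt n * n)"
  proof (rule LIMSEQ_le_const2, intro exI allI impI)
    fix N
    have "norm (\<Sum>k<N. \<Sum>i<n. \<Sum>j<n. b k (matrix_unit i j) * entry i j (a k)) \<le> (\<Sum>k<N. \<beta> k * \<alpha> k)"
      by (rule order_trans[OF norm_sum sum_mono[OF trace]])
    with upper[of N] show "norm (\<Sum>k<N. \<Sum>i<n. \<Sum>j<n. b k (matrix_unit i j) * entry i j (a k))
        \<le> 9 * (B * sqrt n * n)" by linarith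
  qed
  then have "real n * real n \<le> 9 * (B * sqrt n * n)"
    by (simp only: norm_mult norm_of_nat of_nat_mult)
  \<comment> \<open>Splitting off the common factor \<open>sqrt n * n\<close> leaves
    \<open>sqrt n\<close> against a constant.\<close>
  moreover have "real n * real n = sqrt n * (sqrt n * n)" by (simp flip: mult.assoc)
  ultimately have "sqrt n * (sqrt n * n) \<le> 9 * B * (sqrt n * n)" by (simp only: mult.assoc)
  then have "sqrt n \<le> 9 * B" using n by (simp add: mult_le_cancel_right_pos)
  then have "real n \<le> (9 * B)\<^sup>2" by (rule sqrt_le_D)
  with m show False by (simp add: n_def)
qed

theorem corollary9:
  shows "\<not> (\<exists>(a :: nat \<Rightarrow> 'k::{real_normed_field,euclidean_space} compact_ell2)
              (b :: nat \<Rightarrow> 'k compact_ell2 \<Rightarrow> 'k).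
            besselian_schauder_frame scale_compact a b)
       \<and> \<not> (\<exists>(a :: nat \<Rightarrow> 'k compact_ell2) (b :: nat \<Rightarrow> 'k compact_ell2 \<Rightarrow> 'k).
            unconditional_schauder_frame scale_compact a b)"
proof -
  \<comment> \<open>Continuity in the scalar makes the partial sum operators of a frame bounded, as
    the passage from unconditional to Besselian frames requires.\<close>
  have "bounded_linear (\<lambda>c. scale_compact c T)" for T :: "'k compact_ell2"
  proof (rule bounded_linear_intro[where K = "norm T"])
    show "scale_compact (c + d) T = scale_compact c T + scale_compact d T" for c d
      by (rule module.scale_left_distrib[OF vector_space_compact_ell2[folded module_iff_vector_space]])
    show "scale_compact (r *\<^sub>R c) T = r *\<^sub>R scale_compact c T" for r c
      by (simp add: scaleR_compact_ell2_eq scaleR_conv_of_real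
          module.scale_scale[OF vector_space_compact_ell2[folded module_iff_vector_space]])
    show "norm (scale_compact c T) \<le> norm c * norm T" for c
      unfolding norm_compact_ell2.rep_eq[of "scale_compact c T"]
    proof (rule norm_blinfun_bound)
      fix v
      have "norm (blinfun_of_compact (scale_compact c T) v) \<le> norm c * (norm T * norm v)"
        by (simp add: scale_compact_apply norm_scale_ell2 mult_left_mono norm_compact_ell2_apply)
      then show "norm (blinfun_of_compact (scale_compact c T) v) \<le> norm c * norm T * norm v"
        by (simp add: mult.assoc)
    qed simp
  qed
  then show ?thesis
    using no_besselian_schauder_frame unconditional_imp_besselian by blast
qed

end
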